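(* A Gauss code $X$ is realizable in a closed surface of connectivity at most $1$ (i.e. the sphere or the real projective plane) if and only if it is possible to color the symbols of $X$ with two colors so that for every pair $y,z$ of symbols of $X$: the integer $|i_X(y)\cap i_X(z)|+|i_X(y)|\cdot|i_X(z)|$ is odd if and only if $y$ and $z$ are interlaced and have the same color.
   Context: A Gauss code is a cyclic sequence in which each symbol appears exactly twice. Two distinct symbols $p,q$ are interlaced if $(p,q,p,q)$ is a (cyclic) subsequence of $X$; $i_X(p)$ denotes the set of symbols interlaced with $p$. For a closed surface $S$, the connectivity is $2-\chi(S)$. $X$ is realizable in $S$ if there is a 4-regular graph $H$ embedded in $S$ with every face an open disc, whose faces can be properly 2-colored (the two faces on either side of each edge have different colors), having exactly one smooth path (the closed walk that at each vertex leaves along the edge opposite, i.e. non-consecutive in the rotation, to the one by which it arrived), such that, identifying the vertices of $H$ with the symbols of $X$, the cyclic sequence of vertices visited by this smooth path is $X$. *)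

theory Defs
  imports Main "HOL-Library.Sublist"
begin

text \<open>A Gauss code is represented by a list (read cyclically) in which every symbol
  occurring appears exactly twice.\<close>

definition gauss_code :: "'a list \<Rightarrow> bool" where
  "gauss_code X \<longleftrightarrow> (\<forall>a\<in>set X. count_list X a = 2)"

definition interlaced :: "'a list \<Rightarrow> 'a \<Rightarrow> 'a \<Rightarrow> bool" where
  "interlaced X p q \<longleftrightarrow> p \<noteq> q \<and> (\<exists>k. subseq [p, q, p, q] (rotate k X))"

definition interlaced_set :: "'a list \<Rightarrow> 'a \<Rightarrow> 'a set" where
  "interlaced_set X p = {q. interlaced X p q}"

text \<open>A cellularly embedded connected graph in a closed surface is encoded by its
  set of flags F with three fixed-point-free involutions:
  s0 changes the vertex (other end of the same edge, same side),
  s1 changes the edge (same vertex, same face corner),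
  s2 changes the side/face (same vertex, same edge),
  with s0 s2 = s2 s0 fixed-point-free and the generated group transitive.
  Vertices, edges, faces are the orbits of <s1,s2>, <s0,s2>, <s0,s1>.\<close>

definition fpf_involution_on :: "nat set \<Rightarrow> (nat \<Rightarrow> nat) \<Rightarrow> bool" where
  "fpf_involution_on F s \<longleftrightarrow> (\<forall>f\<in>F. s f \<in> F \<and> s (s f) = f \<and> s f \<noteq> f)"

definition gen_rel :: "nat set \<Rightarrow> (nat \<Rightarrow> nat) set \<Rightarrow> nat rel" where
  "gen_rel F S = {(f, s f) | f s. f \<in> F \<and> s \<in> S}"

definition orbit_of :: "nat set \<Rightarrow> (nat \<Rightarrow> nat) set \<Rightarrow> nat \<Rightarrow> nat set" where
  "orbit_of F S f = {g. (f, g) \<in> (gen_rel F S)\<^sup>*}"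

definition is_map :: "nat set \<Rightarrow> (nat \<Rightarrow> nat) \<Rightarrow> (nat \<Rightarrow> nat) \<Rightarrow> (nat \<Rightarrow> nat) \<Rightarrow> bool" where
  "is_map F s0 s1 s2 \<longleftrightarrow>
     finite F \<and> F \<noteq> {} \<and>
     fpf_involution_on F s0 \<and> fpf_involution_on F s1 \<and> fpf_involution_on F s2 \<and>
     (\<forall>f\<in>F. s0 (s2 f) = s2 (s0 f) \<and> s0 (s2 f) \<noteq> f) \<and>
     (\<forall>f\<in>F. orbit_of F {s0, s1, s2} f = F)"

definition map_vertices :: "nat set \<Rightarrow> (nat \<Rightarrow> nat) \<Rightarrow> (nat \<Rightarrow> nat) \<Rightarrow> (nat \<Rightarrow> nat) \<Rightarrow> nat set set" where
  "map_vertices F s0 s1 s2 = orbit_of F {s1, s2} ` F"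

definition map_edges :: "nat set \<Rightarrow> (nat \<Rightarrow> nat) \<Rightarrow> (nat \<Rightarrow> nat) \<Rightarrow> (nat \<Rightarrow> nat) \<Rightarrow> nat set set" where
  "map_edges F s0 s1 s2 = orbit_of F {s0, s2} ` F"

definition map_faces :: "nat set \<Rightarrow> (nat \<Rightarrow> nat) \<Rightarrow> (nat \<Rightarrow> nat) \<Rightarrow> (nat \<Rightarrow> nat) \<Rightarrow> nat set set" where
  "map_faces F s0 s1 s2 = orbit_of F {s0, s1} ` F"

definition map_euler_char :: "nat set \<Rightarrow> (nat \<Rightarrow> nat) \<Rightarrow> (nat \<Rightarrow> nat) \<Rightarrow> (nat \<Rightarrow> nat) \<Rightarrow> int" where
  "map_euler_char F s0 s1 s2 =
     int (card (map_vertices F s0 s1 s2)) - int (card (map_edges F s0 s1 s2))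
     + int (card (map_faces F s0 s1 s2))"

definition map_connectivity :: "nat set \<Rightarrow> (nat \<Rightarrow> nat) \<Rightarrow> (nat \<Rightarrow> nat) \<Rightarrow> (nat \<Rightarrow> nat) \<Rightarrow> int" where
  "map_connectivity F s0 s1 s2 = 2 - map_euler_char F s0 s1 s2"

text \<open>4-regular: every vertex has degree 4, i.e. 8 flags.\<close>

definition four_regular :: "nat set \<Rightarrow> (nat \<Rightarrow> nat) \<Rightarrow> (nat \<Rightarrow> nat) \<Rightarrow> (nat \<Rightarrow> nat) \<Rightarrow> bool" where
  "four_regular F s0 s1 s2 \<longleftrightarrow> (\<forall>f\<in>F. card (orbit_of F {s1, s2} f) = 8)"

definition faces_two_colourable :: "nat set \<Rightarrow> (nat \<Rightarrow> nat) \<Rightarrow> (nat \<Rightarrow> nat) \<Rightarrow> (nat \<Rightarrow> nat) \<Rightarrow> bool" where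
  "faces_two_colourable F s0 s1 s2 \<longleftrightarrow>
     (\<exists>c :: nat \<Rightarrow> bool. \<forall>f\<in>F. c (s0 f) = c f \<and> c (s1 f) = c f \<and> c (s2 f) \<noteq> c f)"

text \<open>Smooth (straight-ahead) step: from a flag f at the dart by which a vertex is entered,
  move to the opposite dart at the same vertex (two steps in the rotation, (s2 s1)^2),
  then along that edge to its other end (s0).\<close>

definition smooth_step :: "(nat \<Rightarrow> nat) \<Rightarrow> (nat \<Rightarrow> nat) \<Rightarrow> (nat \<Rightarrow> nat) \<Rightarrow> nat \<Rightarrow> nat" where
  "smooth_step s0 s1 s2 f = s0 (s2 (s1 (s2 (s1 f))))"

text \<open>The smooth paths correspond to the orbits of <smooth_step, s0, s2> (s2 stays in the
  same dart, s0 reverses the direction of travel). Exactly one smooth path: one orbit.\<close>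

definition one_smooth_path :: "nat set \<Rightarrow> (nat \<Rightarrow> nat) \<Rightarrow> (nat \<Rightarrow> nat) \<Rightarrow> (nat \<Rightarrow> nat) \<Rightarrow> bool" where
  "one_smooth_path F s0 s1 s2 \<longleftrightarrow>
     (\<forall>f\<in>F. orbit_of F {smooth_step s0 s1 s2, s0, s2} f = F)"

text \<open>Identification of vertices with symbols (phi constant on vertices, injective on
  vertices, onto the symbols) such that the smooth path visits the vertices in the
  cyclic order X.\<close>

definition realizes :: "'a list \<Rightarrow> nat set \<Rightarrow> (nat \<Rightarrow> nat) \<Rightarrow> (nat \<Rightarrow> nat) \<Rightarrow> (nat \<Rightarrow> nat) \<Rightarrow> (nat \<Rightarrow> 'a) \<Rightarrow> bool" where
  "realizes X F s0 s1 s2 \<phi> \<longleftrightarrow>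
     (\<forall>f\<in>F. \<phi> (s1 f) = \<phi> f \<and> \<phi> (s2 f) = \<phi> f) \<and>
     (\<forall>f\<in>F. \<forall>g\<in>F. \<phi> f = \<phi> g \<longrightarrow> g \<in> orbit_of F {s1, s2} f) \<and>
     \<phi> ` F = set X \<and>
     (\<exists>f\<in>F. \<forall>k. \<phi> ((smooth_step s0 s1 s2 ^^ k) f) = X ! (k mod length X))"

definition gauss_realizable :: "'a list \<Rightarrow> int \<Rightarrow> bool" where
  "gauss_realizable X k \<longleftrightarrow>
     (\<exists>F s0 s1 s2 \<phi>. is_map F s0 s1 s2 \<and> map_connectivity F s0 s1 s2 = k \<and>
        four_regular F s0 s1 s2 \<and> faces_two_colourable F s0 s1 s2 \<and>
        one_smooth_path F s0 s1 s2 \<and> realizes X F s0 s1 s2 \<phi>)"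

end

theory Submission
  imports Defs "HOL-Library.Z2" "HOL-Library.FuncSet"
begin

text \<open>A face-coloured 4-regular map with a single smooth path spelling \<open>X\<close> is determined by \<open>X\<close>
  together with one bit per symbol, namely which colour of faces meets the corner between the
  two incoming edges at that vertex; conversely all such bits occur. Let \<open>A\<close> be the interlacement
  matrix of \<open>X\<close> over the field of two elements, \<open>D\<close> the diagonal matrix of these bits and
  \<open>B = A + D\<close>. A function that is constant on the faces of one colour is a function on the edges,
  that is, on the gaps of \<open>X\<close>. It jumps by the same amount at both occurrences of a symbol, and the
  face conditions say that the vector of jumps lies in the kernel of \<open>B\<close>, respectively of \<open>B + 1\<close>
  for the other colour. Hence the connectivity is
  \<open>rank B + rank (B + 1) - n = rank (B\<^sup>2 + B)\<close>. The diagonal of \<open>B\<^sup>2 + B\<close> is \<open>|i(y)|\<close> and its other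
  entries are \<open>|i(y) \<inter> i(z)|\<close> plus 1 if \<open>y, z\<close> are interlaced and of equal colour, so
  the parity condition says that this symmetric matrix equals \<open>u u\<^sup>T\<close> for its diagonal \<open>u\<close>,
  which means rank at most one.\<close>

section \<open>Interlacement and occurrences\<close>

\<comment> \<open>These simp rules of the library turn the field operations into bitwise ones.\<close>
declare add_bit_eq_xor [simp del] mult_bit_eq_and [simp del]

section \<open>Arithmetic modulo two\<close>

lemma bit_add_self [simp]: "a + a = (0::bit)"
  by (cases a) (simp_all add: one_add_one)

lemma bit_add_cancel [simp]: "a + (a + b) = (b::bit)"
  by (simp flip: add.assoc)

lemma bit_add_eq_iff: "a + b = c \<longleftrightarrow> a = b + (c::bit)"
  by (metis add.commute bit_add_cancel)

lemma bit_mult_self [simp]: "a * a = (a::bit)"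
  by (cases a) simp_all

lemma of_nat_bit: "(of_nat n :: bit) = of_bool (odd n)"
  by (induction n) auto

lemma length_filter_pair:
  "p \<noteq> q \<Longrightarrow> length (filter (\<lambda>x. x = p \<or> x = q) xs) = count_list xs p + count_list xs q"
  by (induction xs) auto

lemma interlaced_in_set: "interlaced X p q \<Longrightarrow> p \<in> set X \<and> q \<in> set X"
proof -
  assume "interlaced X p q"
  then obtain k where "subseq [p, q, p, q] (rotate k X)"
    by (auto simp: interlaced_def)
  then obtain N where "[p, q, p, q] = nths (rotate k X) N"
    by (auto simp: subseq_conv_nths)
  then have "set [p, q, p, q] \<subseteq> set (rotate k X)"
    by (simp only: set_nths_subset)
  then show ?thesis by simp
qed

text \<open>Erasing all symbols except \<open>p\<close> and \<open>q\<close> leaves a word of length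
  four, and rotating \<open>X\<close> rotates this word. A subsequence of length four is then the
  whole word, and \<open>pqpq\<close> has only two rotations.\<close>

lemma interlaced_iff_filter:
  assumes X: "gauss_code X" and pq: "p \<in> set X" "q \<in> set X" "p \<noteq> q"
  shows "interlaced X p q \<longleftrightarrow>
    filter (\<lambda>x. x = p \<or> x = q) X \<in> {[p, q, p, q], [q, p, q, p]}"
proof
  let ?P = "\<lambda>x. x = p \<or> x = q"
  assume "interlaced X p q"
  then obtain k where k: "subseq [p, q, p, q] (rotate k X)"
    by (auto simp: interlaced_def)
  define u v where "u = filter ?P (take (k mod length X) X)"
    and "v = filter ?P (drop (k mod length X) X)"
  have uv: "filter ?P X = u @ v" "filter ?P (rotate k X) = v @ u"
    by (simp_all add: u_def v_def rotate_drop_take flip: filter_append)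
  have "length (filter ?P X) = 4"
    using X pq by (simp add: length_filter_pair gauss_code_def)
  then have len: "length (filter ?P (rotate k X)) = length [p, q, p, q]"
    using uv by simp
  have "subseq (filter ?P [p, q, p, q]) (filter ?P (rotate k X))"
    using k by (rule subseq_filter)
  then have "subseq [p, q, p, q] (filter ?P (rotate k X))" by simp
  then have vu: "v @ u = [p, q, p, q]"
    using subseq_same_length[OF _ len[symmetric]] uv(2) by simp
  \<comment> \<open>The cut between \<open>v\<close> and \<open>u\<close> has five possible places,
    each giving one of the two alternating words.\<close>
  then have v: "v = take (length v) [p, q, p, q]" and u: "u = drop (length v) [p, q, p, q]"
    by (metis append_eq_conv_conj)+
  have "length v \<le> 4" using arg_cong[OF vu, of length] by simp
  then have "length v = 0 \<or> length v = 1 \<or> length v = 2 \<or> length v = 3 \<or> length v = 4"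
    by arith
  then have "u @ v \<in> {[p, q, p, q], [q, p, q, p]}"
    by (elim disjE; subst u; subst v) simp_all
  then show "filter ?P X \<in> {[p, q, p, q], [q, p, q, p]}"
    unfolding uv .
next
  let ?P = "\<lambda>x. x = p \<or> x = q"
  assume "filter ?P X \<in> {[p, q, p, q], [q, p, q, p]}"
  then consider "filter ?P X = [p, q, p, q]" | "filter ?P X = [q, p, q, p]" by auto
  then show "interlaced X p q"
  proof cases
    case 1
    then have "subseq [p, q, p, q] (rotate 0 X)"
      using subseq_filter_left[of ?P X] by simp
    with pq(3) show ?thesis unfolding interlaced_def by (intro conjI exI[of _ 0])
  next
    \<comment> \<open>Rotating just past the first \<open>q\<close> makes the restricted word begin
      with \<open>p\<close>.\<close>
    case 2
    then obtain a b where ab: "X = a @ q # b" "\<forall>u\<in>set a. \<not> ?P u" "[p, q, p] = filter ?P b"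
      using filter_eq_ConsD[OF 2] by (elim exE conjE) (rule that)
    have rot: "rotate (length (a @ [q])) X = b @ a @ [q]"
      using rotate_append[of "a @ [q]" b] ab(1) by simp
    have "filter ?P a = []" using ab(2) by (auto simp: filter_empty_conv)
    then have "filter ?P (rotate (length (a @ [q])) X) = [p, q, p, q]"
      unfolding rot using ab(3)[symmetric] by simp
    then have "subseq [p, q, p, q] (rotate (length (a @ [q])) X)"
      using subseq_filter_left[of ?P "rotate (length (a @ [q])) X"] by simp
    with pq(3) show ?thesis unfolding interlaced_def by (intro conjI exI[of _ "length (a @ [q])"])
  qed
qed

lemma interlaced_sym: "gauss_code X \<Longrightarrow> interlaced X p q \<Longrightarrow> interlaced X q p"
proof -
  assume X: "gauss_code X" and pq: "interlaced X p q"
  have mem: "p \<in> set X" "q \<in> set X" "p \<noteq> q"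
    using pq interlaced_in_set[OF pq] by (auto simp: interlaced_def)
  have "(\<lambda>x. x = p \<or> x = q) = (\<lambda>x. x = q \<or> x = p)" by auto
  then show ?thesis
    using pq unfolding interlaced_iff_filter[OF X mem]
      interlaced_iff_filter[OF X mem(2,1) mem(3)[symmetric]] by auto
qed

text \<open>Between the two occurrences of \<open>p\<close> the symbol \<open>q\<close> occurs 0, 1
  or 2 times, and the four occurrences alternate exactly in the middle case. Parity is what sums
  modulo two can detect.\<close>

lemma interlaced_split:
  assumes X: "gauss_code X" and split: "X = us @ p # vs @ p # ws" and q: "q \<noteq> p"
  shows "interlaced X p q \<longleftrightarrow> odd (count_list vs q)"
proof (cases "q \<in> set X")
  case False
  then have "q \<notin> set vs" using split by auto
  then show ?thesis using False interlaced_in_set[of X p q] by auto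
next
  case True
  let ?P = "\<lambda>x. x = p \<or> x = q"
  have "p \<in> set X" using split by simp
  then have "count_list X p = 2" "count_list X q = 2"
    using X True unfolding gauss_code_def by blast+
  then have p0: "count_list us p = 0" "count_list vs p = 0" "count_list ws p = 0"
    and q2: "count_list us q + count_list vs q + count_list ws q = 2"
    using split q by auto
  have repl: "count_list xs p = 0 \<Longrightarrow> filter ?P xs = replicate (count_list xs q) q" for xs
    using q by (induction xs) (auto split: if_splits)
  have filt: "filter ?P X = replicate (count_list us q) q @ p # replicate (count_list vs q) q
      @ p # replicate (count_list ws q) q"
    unfolding split using p0 by (simp add: repl)
  define a b c where "a = count_list us q" and "b = count_list vs q" and "c = count_list ws q"
  have "a + b + c = 2" using q2 by (simp add: a_def b_def c_def)
  then have "a \<in> {0, 1, 2}" "b \<in> {0, 1, 2}" "c = 2 - a - b"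
    by (simp_all, arith+)
  then have "replicate a q @ p # replicate b q @ p # replicate c q
      \<in> {[p, q, p, q], [q, p, q, p]} \<longleftrightarrow> odd b"
    using q \<open>a + b + c = 2\<close> by (elim insertE emptyE) (simp_all add: numeral_2_eq_2)
  then show ?thesis
    unfolding interlaced_iff_filter[OF X \<open>p \<in> set X\<close> True q[symmetric]] filt a_def b_def c_def .
qed

section \<open>Sums over segments of a code\<close>

lemma sum_list_map_eq_sum_of_nat_count:
  fixes x :: "'a \<Rightarrow> 'b::comm_semiring_1"
  assumes "finite S" "set xs \<subseteq> S"
  shows "sum_list (map x xs) = (\<Sum>q\<in>S. of_nat (count_list xs q) * x q)"
  using assms(2)
proof (induction xs)
  case (Cons a xs)
  have "(\<Sum>q\<in>S. of_nat (count_list (a # xs) q) * x q)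
      = (\<Sum>q\<in>S. (if q = a then x q else 0) + of_nat (count_list xs q) * x q)"
    by (intro sum.cong) (auto simp: algebra_simps)
  also have "\<dots> = x a + (\<Sum>q\<in>S. of_nat (count_list xs q) * x q)"
    using Cons.prems assms(1) by (simp add: sum.distrib)
  finally show ?case using Cons by simp
qed simp

text \<open>Modulo two only symbols met an odd number of times on the way survive, and these are the
  interlaced ones. This is how the interlacement matrix enters.\<close>

lemma sum_between_occurrences:
  fixes x :: "'a \<Rightarrow> bit"
  assumes X: "gauss_code X" and ij: "i < j" "j < length X" "X ! i = X ! j"
  shows "(\<Sum>t=Suc i..<j. x (X ! t)) = (\<Sum>q\<in>interlaced_set X (X ! i). x q)"
proof -
  define us vs ws where "us = take i X" and "vs = take (j - Suc i) (drop (Suc i) X)"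
    and "ws = drop (Suc j) X"
  have "drop (Suc i) X = vs @ drop j X"
    using ij unfolding vs_def
    by (metis Suc_leI append_take_drop_id drop_drop le_add_diff_inverse2)
  then have split: "X = us @ X ! i # vs @ X ! i # ws"
    unfolding us_def ws_def using ij
    by (metis Cons_nth_drop_Suc append_take_drop_id order.strict_trans)
  have vs: "vs = map ((!) X) [Suc i..<j]"
    using ij unfolding vs_def by (simp add: list_eq_iff_nth_eq)
  have "count_list X (X ! i) = 2"
    using X ij unfolding gauss_code_def by simp
  moreover have "count_list X (X ! i) = count_list (us @ X ! i # vs @ X ! i # ws) (X ! i)"
    by (rule arg_cong[OF split])
  ultimately have p0: "count_list vs (X ! i) = 0" by simp
  have sub: "set vs \<subseteq> set X" unfolding vs_def
    by (meson order.trans set_drop_subset set_take_subset)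
  have "(\<Sum>t=Suc i..<j. x (X ! t)) = sum_list (map x vs)"
    unfolding vs by (simp add: comp_def sum_list_distinct_conv_sum_set)
  also have "\<dots> = (\<Sum>q\<in>set X. of_nat (count_list vs q) * x q)"
    by (rule sum_list_map_eq_sum_of_nat_count[OF _ sub]) simp
  also have "\<dots> = (\<Sum>q\<in>set X. if interlaced X (X ! i) q then x q else 0)"
  proof (rule sum.cong[OF refl])
    fix q
    show "of_nat (count_list vs q) * x q = (if interlaced X (X ! i) q then x q else 0)"
    proof (cases "q = X ! i")
      case True
      then show ?thesis using p0 by (simp add: interlaced_def)
    next
      case False
      then show ?thesis using interlaced_split[OF X split] by (simp add: of_nat_bit)
    qed
  qed
  also have "\<dots> = (\<Sum>q\<in>interlaced_set X (X ! i). x q)"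
    unfolding interlaced_set_def
    by (subst sum.inter_filter[symmetric])
      (auto intro!: sum.cong dest: interlaced_in_set)
  finally show ?thesis .
qed

lemma sum_gauss_code_eq_0:
  fixes x :: "'a \<Rightarrow> bit"
  assumes "gauss_code X"
  shows "(\<Sum>t<length X. x (X ! t)) = 0"
proof -
  have "(\<Sum>t<length X. x (X ! t)) = sum_list (map x X)"
    by (simp add: sum_list_sum_nth atLeast0LessThan)
  also have "\<dots> = (\<Sum>q\<in>set X. of_nat (count_list X q) * x q)"
    by (rule sum_list_map_eq_sum_of_nat_count) auto
  also have "\<dots> = 0"
    using assms by (intro sum.neutral) (simp add: gauss_code_def)
  finally show ?thesis .
qed

lemma length_gauss_code: "gauss_code X \<Longrightarrow> length X = 2 * card (set X)"
proof -
  assume X: "gauss_code X"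
  have "length X = (\<Sum>a\<in>set X. count_list X a)"
    by (simp add: sum_count_set)
  also have "\<dots> = (\<Sum>a\<in>set X. 2)"
    using X by (intro sum.cong) (auto simp: gauss_code_def)
  finally show ?thesis by simp
qed

section \<open>Kernels of matrices over the field of two elements\<close>

text \<open>Vectors over the field of two elements indexed by \<^term>\<open>S\<close> are functions vanishing
  outside \<^term>\<open>S\<close>, and matrices are functions of two arguments.\<close>

definition vecs :: "'a set \<Rightarrow> ('a \<Rightarrow> bit) set" where
  "vecs S = {x. \<forall>p. p \<notin> S \<longrightarrow> x p = 0}"

definition mat_vec :: "'a set \<Rightarrow> ('a \<Rightarrow> 'a \<Rightarrow> bit) \<Rightarrow> ('a \<Rightarrow> bit) \<Rightarrow> 'a \<Rightarrow> bit" where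
  "mat_vec S M x p = (if p \<in> S then \<Sum>q\<in>S. M p q * x q else 0)"

definition mat_ker :: "'a set \<Rightarrow> ('a \<Rightarrow> 'a \<Rightarrow> bit) \<Rightarrow> ('a \<Rightarrow> bit) set" where
  "mat_ker S M = {x \<in> vecs S. \<forall>p. mat_vec S M x p = 0}"

lemma card_vecs: "finite S \<Longrightarrow> card (vecs S) = 2 ^ card S"
proof -
  assume S: "finite S"
  have "bij_betw (\<lambda>A p. of_bool (p \<in> A)) (Pow S) (vecs S)"
  proof (rule bij_betwI[where g = "\<lambda>x. {p. x p = 1}"])
    show "(\<lambda>x. {p. x p = 1}) \<in> vecs S \<rightarrow> Pow S"
      by (auto simp: vecs_def)
    show "(\<lambda>p. of_bool (p \<in> {p. x p = 1})) = x" if "x \<in> vecs S" for x :: "'a \<Rightarrow> bit"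
      by (rule ext) (metis (mono_tags, lifting) bit.exhaust mem_Collect_eq of_bool_eq(1,2) zero_neq_one)
  qed (auto simp: vecs_def)
  then show ?thesis using S by (metis bij_betw_same_card card_Pow)
qed

text \<open>The cardinality is a power of two, hence nonzero, whereas infinite sets have cardinality
  0.\<close>

lemma finite_vecs: "finite S \<Longrightarrow> finite (vecs S)"
  by (metis card_vecs card.infinite power_not_zero zero_neq_numeral)

lemma finite_mat_ker: "finite S \<Longrightarrow> finite (mat_ker S M)"
  by (rule finite_subset[OF _ finite_vecs]) (auto simp: mat_ker_def)

lemma vecs_add: "x \<in> vecs S \<Longrightarrow> y \<in> vecs S \<Longrightarrow> (\<lambda>p. x p + y p) \<in> vecs S"
  by (simp add: vecs_def)

lemma mat_vec_in_vecs: "mat_vec S M x \<in> vecs S"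
  by (simp add: vecs_def mat_vec_def)

lemma mat_vec_add: "mat_vec S M (\<lambda>p. x p + y p) p = mat_vec S M x p + mat_vec S M y p"
  by (simp add: mat_vec_def distrib_left sum.distrib)

lemma mat_vec_unit:
  "finite S \<Longrightarrow> q \<in> S \<Longrightarrow> p \<in> S \<Longrightarrow> mat_vec S M (\<lambda>r. of_bool (r = q)) p = M p q"
  by (simp add: mat_vec_def)

text \<open>The kernels of \<open>B\<close> and \<open>C = B + 1\<close> are complementary in the kernel of \<open>M = B (B + 1)\<close>,
  because \<open>B\<close> and \<open>B + 1\<close> add up to the identity.\<close>

lemma card_mat_ker_times:
  assumes S: "finite S"
    and C: "\<And>x p. x \<in> vecs S \<Longrightarrow> mat_vec S C x p = mat_vec S B x p + x p"
    and M: "\<And>x p. x \<in> vecs S \<Longrightarrow> mat_vec S M x p = mat_vec S B (mat_vec S B x) p + mat_vec S B x p"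
  shows "card (mat_ker S B) * card (mat_ker S C) = card (mat_ker S M)"
proof -
  have add: "mat_vec S B (\<lambda>p. x p + y p) = (\<lambda>p. mat_vec S B x p + mat_vec S B y p)" for x y
    by (rule ext) (rule mat_vec_add)
  have z: "mat_vec S B (\<lambda>p. 0) = (\<lambda>p. 0)"
    by (simp add: mat_vec_def fun_eq_iff)
  have kB: "x \<in> mat_ker S B \<longleftrightarrow> x \<in> vecs S \<and> mat_vec S B x = (\<lambda>p. 0)" for x
    by (auto simp: mat_ker_def fun_eq_iff)
  \<comment> \<open>In characteristic two the kernel of \<open>B + 1\<close> is the set of fixed
    vectors of \<open>B\<close>.\<close>
  have kC: "x \<in> mat_ker S C \<longleftrightarrow> x \<in> vecs S \<and> mat_vec S B x = x" for x
    using C[of x] by (auto simp: mat_ker_def fun_eq_iff bit_add_eq_iff)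
  have kM: "x \<in> mat_ker S M \<longleftrightarrow> x \<in> vecs S \<and> mat_vec S B (mat_vec S B x) = mat_vec S B x" for x
    using M[of x] by (auto simp: mat_ker_def fun_eq_iff bit_add_eq_iff)
  \<comment> \<open>The inverse splits \<open>w\<close> into \<open>w + B w\<close> and
    \<open>B w\<close>: on the kernel of \<open>M\<close>, the first part is killed by
    \<open>B\<close> and the second is fixed by it.\<close>
  have "bij_betw (\<lambda>(x, y) p. x p + y p) (mat_ker S B \<times> mat_ker S C) (mat_ker S M)"
  proof (rule bij_betwI[where g = "\<lambda>w. (\<lambda>p. w p + mat_vec S B w p, mat_vec S B w)"])
    show "(\<lambda>(x, y) p. x p + y p) \<in> mat_ker S B \<times> mat_ker S C \<rightarrow> mat_ker S M"
      by (auto simp: kB kC kM add vecs_add)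
    show "(\<lambda>w. (\<lambda>p. w p + mat_vec S B w p, mat_vec S B w)) \<in> mat_ker S M \<rightarrow> mat_ker S B \<times> mat_ker S C"
    proof
      fix w assume "w \<in> mat_ker S M"
      then have w: "w \<in> vecs S" "mat_vec S B (mat_vec S B w) = mat_vec S B w"
        by (simp_all add: kM)
      have "mat_vec S B (\<lambda>p. w p + mat_vec S B w p) = (\<lambda>p. 0)"
        unfolding add w(2) by simp
      then show "(\<lambda>p. w p + mat_vec S B w p, mat_vec S B w) \<in> mat_ker S B \<times> mat_ker S C"
        using w by (simp add: kB kC vecs_add mat_vec_in_vecs)
    qed
  next
    fix z assume "z \<in> mat_ker S B \<times> mat_ker S C"
    then obtain x y where z: "z = (x, y)" "x \<in> mat_ker S B" "y \<in> mat_ker S C" by blast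
    then have "mat_vec S B (\<lambda>p. x p + y p) = y"
      unfolding add by (simp add: kB kC)
    then show "(\<lambda>w. (\<lambda>p. w p + mat_vec S B w p, mat_vec S B w)) ((\<lambda>(x, y) p. x p + y p) z) = z"
      unfolding z by (simp add: ac_simps)
  next
    fix w
    show "(\<lambda>(x, y) p. x p + y p) ((\<lambda>w. (\<lambda>p. w p + mat_vec S B w p, mat_vec S B w)) w) = w"
      by (simp add: ac_simps)
  qed
  then show ?thesis
    by (simp add: bij_betw_same_card flip: card_cartesian_product)
qed

text \<open>Given two distinct nonzero columns, the kernel and two translates of it are
  disjoint, which leaves no room if its codimension is at most one.\<close>

lemma large_mat_ker_iff:
  assumes S: "finite S" and sym: "\<And>p q. p \<in> S \<Longrightarrow> q \<in> S \<Longrightarrow> M p q = M q p"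
  shows "2 ^ card S \<le> 2 * card (mat_ker S M) \<longleftrightarrow> (\<forall>p\<in>S. \<forall>q\<in>S. M p q = M p p * M q q)"
proof
  assume large: "2 ^ card S \<le> 2 * card (mat_ker S M)"
  define e :: "'a \<Rightarrow> 'a \<Rightarrow> bit" where "e q = (\<lambda>r. of_bool (r = q))" for q
  \<comment> \<open>\<open>tr q\<close> is the kernel translated by the unit vector at
    \<open>q\<close>; \<open>M\<close> sends all of it to column \<open>q\<close>.\<close>
  define tr where "tr q = (\<lambda>x r. x r + e q r) ` mat_ker S M" for q
  have card_tr: "card (tr q) = card (mat_ker S M)" for q
    unfolding tr_def by (rule card_image) (auto simp: inj_on_def fun_eq_iff)
  have tr_vec: "mat_vec S M x p = M p q" if "x \<in> tr q" "p \<in> S" "q \<in> S" for x p q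
    using that S unfolding tr_def e_def by (auto simp: mat_vec_add mat_vec_unit mat_ker_def)
  have tr_sub: "tr q \<subseteq> vecs S" if "q \<in> S" for q
    using that unfolding tr_def mat_ker_def e_def by (auto simp: vecs_def)
  have ker_sub: "mat_ker S M \<subseteq> vecs S" by (auto simp: mat_ker_def)
  show "\<forall>p\<in>S. \<forall>q\<in>S. M p q = M p p * M q q"
  proof (intro ballI)
    fix p q assume pq: "p \<in> S" "q \<in> S"
    \<comment> \<open>Three disjoint nonempty sets of the size of the kernel do not fit into a space
      of at most twice that size.\<close>
    have "\<not> (mat_ker S M \<inter> tr p = {} \<and> mat_ker S M \<inter> tr q = {} \<and> tr p \<inter> tr q = {})"
    proof
      assume disj: "mat_ker S M \<inter> tr p = {} \<and> mat_ker S M \<inter> tr q = {} \<and> tr p \<inter> tr q = {}"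
      have fin: "finite (tr p)" "finite (tr q)" "finite (mat_ker S M)"
        using tr_sub pq ker_sub finite_vecs[OF S] by (meson finite_subset)+
      have "card (mat_ker S M \<union> (tr p \<union> tr q)) = 3 * card (mat_ker S M)"
        using disj fin by (subst card_Un_disjoint) (auto simp: card_Un_disjoint card_tr)
      moreover have "card (mat_ker S M \<union> (tr p \<union> tr q)) \<le> card (vecs S)"
        using tr_sub pq ker_sub finite_vecs[OF S] by (intro card_mono) auto
      ultimately have "3 * card (mat_ker S M) \<le> 2 * card (mat_ker S M)"
        using large card_vecs[OF S] by linarith
      moreover have "card (mat_ker S M) > 0"
        using large by (cases "card (mat_ker S M)") auto
      ultimately show False by linarith
    qed
    \<comment> \<open>The three intersections mean in turn that column \<open>p\<close> vanishes,
      that column \<open>q\<close> vanishes, or that the two columns agree.\<close>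
    then consider (1) x where "x \<in> mat_ker S M" "x \<in> tr p" | (2) x where "x \<in> mat_ker S M" "x \<in> tr q"
      | (3) x where "x \<in> tr p" "x \<in> tr q" by blast
    then show "M p q = M p p * M q q"
    proof cases
      case 1
      then have "M r p = 0" if "r \<in> S" for r
        using tr_vec[of x p r] pq that by (simp add: mat_ker_def)
      then show ?thesis using pq sym[of p q] by simp
    next
      case 2
      then have "M r q = 0" if "r \<in> S" for r
        using tr_vec[of x q r] pq that by (simp add: mat_ker_def)
      then show ?thesis using pq by simp
    next
      case 3
      then have "M r p = M r q" if "r \<in> S" for r
        using tr_vec[of x p r] tr_vec[of x q r] pq that by simp
      then have "M p p = M p q" "M q p = M q q" using pq by auto
      then show ?thesis using sym pq by simp
    qed
  qed
next
  assume rank1: "\<forall>p\<in>S. \<forall>q\<in>S. M p q = M p p * M q q"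
  \<comment> \<open>Now \<open>M\<close> is the outer product of its diagonal with itself and
    \<open>f\<close> is the pairing with that diagonal, so \<open>M\<close> kills every vector on
    which \<open>f\<close> vanishes.\<close>
  define f where "f x = (\<Sum>q\<in>S. M q q * x q)" for x :: "'a \<Rightarrow> bit"
  have "mat_vec S M x p = (if p \<in> S then M p p * f x else 0)" for x p
  proof (cases "p \<in> S")
    case True
    have "(\<Sum>q\<in>S. M p q * x q) = (\<Sum>q\<in>S. M p p * (M q q * x q))"
      by (rule sum.cong[OF refl]) (use bspec[OF bspec[OF rank1 True]] in \<open>simp only: mult.assoc\<close>)
    then show ?thesis using True by (simp add: mat_vec_def f_def sum_distrib_left)
  qed (simp add: mat_vec_def)
  then have ker: "{x \<in> vecs S. f x = 0} \<subseteq> mat_ker S M"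
    by (auto simp: mat_ker_def)
  have f_add: "f (\<lambda>p. x p + y p) = f x + f y" for x y
    by (simp add: f_def distrib_left sum.distrib)
  have sub: "vecs S \<subseteq> mat_ker S M \<union> {x \<in> vecs S. f x = 1}"
    using ker by auto
  have "card (vecs S) \<le> card (mat_ker S M \<union> {x \<in> vecs S. f x = 1})"
    using finite_mat_ker[OF S] finite_vecs[OF S] by (intro card_mono[OF _ sub]) simp
  also have "\<dots> \<le> card (mat_ker S M) + card {x \<in> vecs S. f x = 1}"
    by (rule card_Un_le)
  finally have "card (vecs S) \<le> card (mat_ker S M) + card {x \<in> vecs S. f x = 1}" .
  moreover have "card {x \<in> vecs S. f x = 1} \<le> card (mat_ker S M)"
  proof (cases "{x \<in> vecs S. f x = 1} = {}")
    case False
    \<comment> \<open>Translation by \<open>w\<close> embeds the vectors with \<open>f x = 1\<close>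
      into those with \<open>f x = 0\<close>.\<close>
    then obtain w where w: "w \<in> vecs S" "f w = 1" by auto
    have "(\<lambda>x p. x p + w p) ` {x \<in> vecs S. f x = 1} \<subseteq> {x \<in> vecs S. f x = 0}"
      using w by (auto simp: f_add vecs_add)
    then have "(\<lambda>x p. x p + w p) ` {x \<in> vecs S. f x = 1} \<subseteq> mat_ker S M" using ker by blast
    then show ?thesis
      by (rule card_inj_on_le[rotated]) (auto simp: inj_on_def fun_eq_iff finite_mat_ker S)
  qed (simp only: card.empty)
  ultimately show "2 ^ card S \<le> 2 * card (mat_ker S M)"
    using card_vecs[OF S] by linarith
qed

section \<open>Boundary curves of a coloured code\<close>

definition interlace_mat :: "'a list \<Rightarrow> ('a \<Rightarrow> bool) \<Rightarrow> 'a \<Rightarrow> 'a \<Rightarrow> bit" where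
  "interlace_mat X d p q = of_bool (interlaced X p q) + of_bool (p = q \<and> d p)"

text \<open>The functions on the gaps of the cyclic word \<^term>\<open>X\<close>, gap \<open>i\<close> preceding position \<open>i\<close>,
  that are constant along the boundary curves of one colour: at a symbol with \<^term>\<open>d p\<close>
  the curves pass from the gap before one occurrence to the gap before the other,
  otherwise from the gap before one to the gap after the other.\<close>

definition gap_funs :: "'a list \<Rightarrow> ('a \<Rightarrow> bool) \<Rightarrow> (nat \<Rightarrow> bit) set" where
  "gap_funs X d = {g. (\<forall>i. g (i + length X) = g i) \<and>
     (\<forall>i<length X. \<forall>j<length X. i \<noteq> j \<longrightarrow> X ! i = X ! j \<longrightarrow>
        (if d (X ! i) then g i = g j \<and> g (Suc i) = g (Suc j)
         else g (Suc i) = g j \<and> g i = g (Suc j)))}"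

lemma gap_funsD:
  assumes "g \<in> gap_funs X d" "i < length X" "j < length X" "i \<noteq> j" "X ! i = X ! j"
  shows "if d (X ! i) then g i = g j \<and> g (Suc i) = g (Suc j)
    else g (Suc i) = g j \<and> g i = g (Suc j)"
  using assms unfolding gap_funs_def by blast

text \<open>The gap function with value \<open>a\<close> at gap 0 and jump \<open>x p\<close> at
  each occurrence of \<open>p\<close>, on the unrolled cyclic word.\<close>

definition prefix_sum :: "'a list \<Rightarrow> bit \<Rightarrow> ('a \<Rightarrow> bit) \<Rightarrow> nat \<Rightarrow> bit" where
  "prefix_sum X a x k = a + (\<Sum>t<k. x (X ! (t mod length X)))"

lemma prefix_sum_Suc [simp]: "prefix_sum X a x (Suc k) = prefix_sum X a x k + x (X ! (k mod length X))"
  by (simp add: prefix_sum_def ac_simps)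

lemma prefix_sum_0 [simp]: "prefix_sum X a x 0 = a"
  by (simp add: prefix_sum_def)

text \<open>Around the whole cycle each symbol jumps twice, so the total change is zero modulo
  two.\<close>

lemma prefix_sum_period:
  assumes "gauss_code X"
  shows "prefix_sum X a x (k + length X) = prefix_sum X a x k"
proof (induction k)
  case 0
  have "(\<Sum>t<length X. x (X ! (t mod length X))) = 0"
    using sum_gauss_code_eq_0[OF assms, of x] by simp
  then show ?case by (simp add: prefix_sum_def)
qed simp

lemma other_occurrence:
  assumes X: "gauss_code X" and i: "i < length X"
  obtains j where "j < length X" "j \<noteq> i" "X ! j = X ! i"
    "\<And>k. k < length X \<Longrightarrow> X ! k = X ! i \<Longrightarrow> k = i \<or> k = j"
proof -
  have "card {k. k < length X \<and> X ! k = X ! i} = 2"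
  proof -
    have "count_list X (X ! i) = 2" using X i by (simp add: gauss_code_def)
    then show ?thesis
      by (simp add: count_list_eq_length_filter length_filter_conv_card eq_commute[of "X ! i"])
  qed
  then obtain u v where uv: "{k. k < length X \<and> X ! k = X ! i} = {u, v}" "u \<noteq> v"
    by (auto simp: card_2_iff)
  then have "i = u \<or> i = v" using i by auto
  then show ?thesis
  proof
    assume "i = u" then show ?thesis using that[of v] uv by auto
  next
    assume "i = v" then show ?thesis using that[of u] uv by auto
  qed
qed

lemma prefix_sum_between:
  assumes X: "gauss_code X" and ij: "i < j" "j < length X" "X ! i = X ! j"
  shows "prefix_sum X a x j = prefix_sum X a x i + x (X ! i) + (\<Sum>q\<in>interlaced_set X (X ! i). x q)"
proof -
  have "(\<Sum>t<j. x (X ! t)) = (\<Sum>t<i. x (X ! t)) + (\<Sum>t=i..<j. x (X ! t))"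
    using ij by (simp add: sum.atLeastLessThan_concat flip: atLeast0LessThan)
  \<comment> \<open>Gap \<open>j\<close> lies before position \<open>j\<close>, so the jump at
    \<open>i\<close> is counted and the jump at \<open>j\<close> is not.\<close>
  also have "(\<Sum>t=i..<j. x (X ! t)) = x (X ! i) + (\<Sum>t=Suc i..<j. x (X ! t))"
    using ij by (simp add: sum.atLeast_Suc_lessThan)
  finally show ?thesis
    unfolding prefix_sum_def using sum_between_occurrences[OF X ij, of x] ij by (simp add: ac_simps)
qed

lemma interlaced_set_subset: "interlaced_set X p \<subseteq> set X"
  using interlaced_in_set by (fastforce simp: interlaced_set_def)

lemma mat_vec_interlace:
  assumes "p \<in> set X"
  shows "mat_vec (set X) (interlace_mat X d) x p = (\<Sum>q\<in>interlaced_set X p. x q) + of_bool (d p) * x p"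
proof -
  have "mat_vec (set X) (interlace_mat X d) x p =
      (\<Sum>q\<in>set X. (if q \<in> interlaced_set X p then x q else 0) + (if q = p then of_bool (d p) * x p else 0))"
    using assms unfolding mat_vec_def interlace_mat_def if_P[OF assms]
    by (intro sum.cong) (auto simp: distrib_right interlaced_set_def)
  also have "\<dots> = (\<Sum>q\<in>set X. if q \<in> interlaced_set X p then x q else 0) + of_bool (d p) * x p"
    using assms by (simp add: sum.distrib)
  also have "(\<Sum>q\<in>set X. if q \<in> interlaced_set X p then x q else 0) = (\<Sum>q\<in>interlaced_set X p. x q)"
    using interlaced_set_subset[of X p]
    by (simp add: sum.inter_restrict[symmetric] Int_absorb1)
  finally show ?thesis .
qed

text \<open>Both occurrences of a symbol carry the same jump, so its two equations are equivalent.
  Comparing gap \<open>i\<close> with gap \<open>j\<close> retains the symbol's own jump, comparing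
  gap \<open>Suc i\<close> with gap \<open>j\<close> cancels it; this difference is the diagonal bit
  of the matrix row.\<close>

lemma prefix_sum_in_gap_funs_iff:
  assumes X: "gauss_code X" and x: "x \<in> vecs (set X)"
  shows "prefix_sum X a x \<in> gap_funs X d \<longleftrightarrow> x \<in> mat_ker (set X) (interlace_mat X d)"
proof -
  let ?g = "prefix_sum X a x"
  define y where "y p = mat_vec (set X) (interlace_mat X d) x p" for p
  have key: "(if d (X ! i) then ?g i = ?g j \<and> ?g (Suc i) = ?g (Suc j)
         else ?g (Suc i) = ?g j \<and> ?g i = ?g (Suc j)) \<longleftrightarrow> y (X ! i) = 0"
    if ij: "i < length X" "j < length X" "i \<noteq> j" "X ! i = X ! j" for i j
  proof -
    have y: "y (X ! i) = (\<Sum>q\<in>interlaced_set X (X ! i). x q) + of_bool (d (X ! i)) * x (X ! i)"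
      using ij unfolding y_def by (subst mat_vec_interlace) auto
    \<comment> \<open>The relation is symmetric in \<open>i\<close> and \<open>j\<close>, as signs
      do not matter modulo two.\<close>
    have "?g j = ?g i + x (X ! i) + (\<Sum>q\<in>interlaced_set X (X ! i). x q)"
    proof (cases "i < j")
      case True
      then show ?thesis using prefix_sum_between[OF X True] ij by simp
    next
      case False
      then have "?g i = ?g j + x (X ! j) + (\<Sum>q\<in>interlaced_set X (X ! j). x q)"
        using prefix_sum_between[OF X, of j i] ij by simp
      then show ?thesis using ij by (simp add: ac_simps)
    qed
    then show ?thesis
      using ij unfolding y by (cases "x (X ! i)"; cases "?g i"; cases "\<Sum>q\<in>interlaced_set X (X ! i). x q") auto
  qed
  have "?g \<in> gap_funs X d \<longleftrightarrow>
      (\<forall>i<length X. \<forall>j<length X. i \<noteq> j \<longrightarrow> X ! i = X ! j \<longrightarrow> y (X ! i) = 0)"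
    unfolding gap_funs_def using key prefix_sum_period[OF X] by simp
  also have "\<dots> \<longleftrightarrow> (\<forall>i<length X. y (X ! i) = 0)"
    using other_occurrence[OF X] by metis
  also have "\<dots> \<longleftrightarrow> (\<forall>p\<in>set X. y p = 0)"
    by (metis in_set_conv_nth)
  also have "\<dots> \<longleftrightarrow> x \<in> mat_ker (set X) (interlace_mat X d)"
    using x by (auto simp: mat_ker_def y_def mat_vec_def)
  finally show ?thesis .
qed

text \<open>Adding the two equations of a symbol shows in either case that \<open>g\<close> jumps
  equally at both occurrences. The jump thus depends on the symbol only, and summation recovers
  \<open>g\<close>.\<close>

lemma gap_fun_eq_prefix_sum:
  assumes X: "X \<noteq> []" and g: "g \<in> gap_funs X d"
  obtains x where "x \<in> vecs (set X)" "g = prefix_sum X (g 0) x"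
proof -
  define f where "f i = g i + g (Suc i)" for i
  have fij: "f i = f j" if "i < length X" "j < length X" "X ! i = X ! j" for i j
  proof (cases "i = j")
    case False
    then show ?thesis
      using gap_funsD[OF g that(1,2) _ that(3)] by (simp add: f_def add.commute split: if_splits)
  qed simp
  \<comment> \<open>By \<open>fij\<close> any occurrence may be chosen; the value 0 elsewhere puts
    \<open>x\<close> into \<open>vecs\<close>.\<close>
  define x where "x p = (if p \<in> set X then f (SOME i. i < length X \<and> X ! i = p) else 0)" for p
  have x: "x (X ! i) = f i" if "i < length X" for i
  proof -
    have "(SOME j. j < length X \<and> X ! j = X ! i) < length X \<and> X ! (SOME j. j < length X \<and> X ! j = X ! i) = X ! i"
      using that by (intro someI[of "\<lambda>j. j < length X \<and> X ! j = X ! i" i]) simp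
    then have "f (SOME j. j < length X \<and> X ! j = X ! i) = f i"
      using that by (intro fij) blast+
    then show ?thesis using that by (simp add: x_def)
  qed
  have g_add: "g (i + length X) = g i" for i
    using g by (simp add: gap_funs_def)
  have per: "g (i + m * length X) = g i" for i m
  proof (induction m)
    case (Suc m)
    then show ?case using g_add[of "i + m * length X"] by (simp add: ac_simps)
  qed simp
  have f_mod: "f (k mod length X) = f k" for k
    using per[of "k mod length X" "k div length X"] per[of "Suc (k mod length X)" "k div length X"]
    by (simp add: f_def)
  have "g k = prefix_sum X (g 0) x k" for k
  proof (induction k)
    case (Suc k)
    have "x (X ! (k mod length X)) = g k + g (Suc k)"
      using x[of "k mod length X"] f_mod[of k] X by (simp add: f_def)
    then show ?case by (simp flip: Suc)
  qed simp
  then have "g = prefix_sum X (g 0) x" by blast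
  moreover have "x \<in> vecs (set X)" by (simp add: vecs_def x_def)
  ultimately show ?thesis by (rule that[rotated])
qed

text \<open>A gap function amounts to its value at gap 0, which is free and gives the factor 2,
  together with its vector of jumps.\<close>

lemma card_gap_funs:
  assumes X: "gauss_code X" "X \<noteq> []"
  shows "card (gap_funs X d) = 2 * card (mat_ker (set X) (interlace_mat X d))"
proof -
  let ?K = "mat_ker (set X) (interlace_mat X d)"
  have K: "?K \<subseteq> vecs (set X)" by (auto simp: mat_ker_def)
  have "bij_betw (\<lambda>(a, x). prefix_sum X a x) (UNIV \<times> ?K) (gap_funs X d)"
    unfolding bij_betw_def
  proof
    show "inj_on (\<lambda>(a, x). prefix_sum X a x) (UNIV \<times> ?K)"
    proof (rule inj_onI, clarify)
      fix a x b y
      assume xy: "x \<in> ?K" "y \<in> ?K" and eq: "prefix_sum X a x = prefix_sum X b y"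
      have "a = b" using fun_cong[OF eq, of 0] by simp
      have "x (X ! i) = y (X ! i)" if "i < length X" for i
        using fun_cong[OF eq, of i] fun_cong[OF eq, of "Suc i"] that \<open>a = b\<close> by simp
      then have "x p = y p" if "p \<in> set X" for p
        using that by (auto simp: in_set_conv_nth)
      moreover have "x p = y p" if "p \<notin> set X" for p
        using xy that by (simp add: mat_ker_def vecs_def)
      ultimately have "x p = y p" for p by blast
      with \<open>a = b\<close> show "a = b \<and> x = y" by auto
    qed
    show "(\<lambda>(a, x). prefix_sum X a x) ` (UNIV \<times> ?K) = gap_funs X d"
    proof (intro equalityI subsetI)
      fix g assume "g \<in> (\<lambda>(a, x). prefix_sum X a x) ` (UNIV \<times> ?K)"
      then show "g \<in> gap_funs X d"
        using prefix_sum_in_gap_funs_iff[OF X(1)] K by auto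
    next
      fix g assume g: "g \<in> gap_funs X d"
      then obtain x where "x \<in> vecs (set X)" "g = prefix_sum X (g 0) x"
        using gap_fun_eq_prefix_sum[OF X(2)] by metis
      then have "x \<in> ?K"
        using g prefix_sum_in_gap_funs_iff[OF X(1), of x "g 0" d] by metis
      then have "(\<lambda>(a, x). prefix_sum X a x) (g 0, x) \<in> (\<lambda>(a, x). prefix_sum X a x) ` (UNIV \<times> ?K)"
        by blast
      then show "g \<in> (\<lambda>(a, x). prefix_sum X a x) ` (UNIV \<times> ?K)"
        unfolding prod.case \<open>g = prefix_sum X (g 0) x\<close>[symmetric] .
    qed
  qed
  moreover have "card (UNIV :: bit set) = 2"
  proof -
    have "(UNIV :: bit set) = {0, 1}" using bit_not_one_iff by blast
    then show ?thesis by (simp only: card_2_iff) (use zero_neq_one in blast)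
  qed
  ultimately show ?thesis
    by (simp add: card_cartesian_product flip: bij_betw_same_card)
qed

section \<open>Orbits of involutions\<close>

lemma orbit_of_refl: "f \<in> orbit_of F S f"
  by (simp add: orbit_of_def)

lemma orbit_of_step: "g \<in> orbit_of F S f \<Longrightarrow> g \<in> F \<Longrightarrow> s \<in> S \<Longrightarrow> s g \<in> orbit_of F S f"
  unfolding orbit_of_def gen_rel_def by (blast intro: rtrancl_into_rtrancl)

lemma orbit_of_trans: "g \<in> orbit_of F S f \<Longrightarrow> h \<in> orbit_of F S g \<Longrightarrow> h \<in> orbit_of F S f"
  unfolding orbit_of_def by (blast intro: rtrancl_trans)

text \<open>Orbits are bounded from above by this rule, often with \<open>A\<close> cut out by an
  invariant.\<close>

lemma orbit_of_least:
  assumes "f \<in> A" and "\<And>g s. g \<in> A \<Longrightarrow> s \<in> S \<Longrightarrow> s g \<in> A"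
  shows "orbit_of F S f \<subseteq> A"
proof
  fix g assume "g \<in> orbit_of F S f"
  then have "(f, g) \<in> (gen_rel F S)\<^sup>*" by (simp add: orbit_of_def)
  then show "g \<in> A"
    by (induction rule: rtrancl_induct) (use assms in \<open>auto simp: gen_rel_def\<close>)
qed

lemma orbit_of_subset:
  assumes "\<And>s. s \<in> S \<Longrightarrow> fpf_involution_on F s" and "f \<in> F"
  shows "orbit_of F S f \<subseteq> F"
  by (rule orbit_of_least) (use assms in \<open>auto simp: fpf_involution_on_def\<close>)

text \<open>Reachability is symmetric because every generator undoes itself.\<close>

lemma orbit_of_sym:
  assumes S: "\<And>s. s \<in> S \<Longrightarrow> fpf_involution_on F s" and f: "f \<in> F"
    and g: "g \<in> orbit_of F S f"
  shows "f \<in> orbit_of F S g"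
proof -
  have "orbit_of F S f \<subseteq> {g \<in> F. f \<in> orbit_of F S g}"
  proof (rule orbit_of_least)
    show "f \<in> {g \<in> F. f \<in> orbit_of F S g}" using f by (simp add: orbit_of_refl)
    fix h s assume h: "h \<in> {g \<in> F. f \<in> orbit_of F S g}" and s: "s \<in> S"
    then have *: "s h \<in> F" "s (s h) = h" using S[OF s] by (auto simp: fpf_involution_on_def)
    then have "h \<in> orbit_of F S (s h)"
      using orbit_of_step[OF orbit_of_refl, of "s h" F s S] s by simp
    then show "s h \<in> {g \<in> F. f \<in> orbit_of F S g}"
      using h * orbit_of_trans by blast
  qed
  then show ?thesis using g by blast
qed

lemma orbit_of_eq:
  assumes S: "\<And>s. s \<in> S \<Longrightarrow> fpf_involution_on F s" and f: "f \<in> F"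
    and g: "g \<in> orbit_of F S f"
  shows "orbit_of F S g = orbit_of F S f"
  using orbit_of_trans orbit_of_sym[OF S f g] g by blast

lemma card_orbits:
  assumes fin: "finite F" and S: "\<And>s. s \<in> S \<Longrightarrow> fpf_involution_on F s"
    and k: "\<And>f. f \<in> F \<Longrightarrow> card (orbit_of F S f) = k"
  shows "k * card (orbit_of F S ` F) = card F"
proof -
  have U: "\<Union> (orbit_of F S ` F) = F"
    using orbit_of_subset[OF S] orbit_of_refl by fast
  have "k * card (orbit_of F S ` F) = card (\<Union> (orbit_of F S ` F))"
  proof (rule card_partition)
    fix c d assume "c \<in> orbit_of F S ` F" "d \<in> orbit_of F S ` F" and ne: "c \<noteq> d"
    then obtain f g where "f \<in> F" "g \<in> F" "c = orbit_of F S f" "d = orbit_of F S g" by blast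
    then show "c \<inter> d = {}" using orbit_of_eq[OF S] ne by blast
  qed (use fin k U in auto)
  then show ?thesis using U by simp
qed

text \<open>Invariant functions are functions on the set of orbits. Counting them will replace a
  direct count of the faces.\<close>

lemma card_invariant_funs:
  assumes fin: "finite F" and S: "\<And>s. s \<in> S \<Longrightarrow> fpf_involution_on F s"
  shows "card {h :: nat \<Rightarrow> bit. (\<forall>f. f \<notin> F \<longrightarrow> h f = 0) \<and> (\<forall>f\<in>F. \<forall>s\<in>S. h (s f) = h f)}
    = 2 ^ card (orbit_of F S ` F)"
proof -
  let ?P = "orbit_of F S ` F"
  let ?I = "{h :: nat \<Rightarrow> bit. (\<forall>f. f \<notin> F \<longrightarrow> h f = 0) \<and> (\<forall>f\<in>F. \<forall>s\<in>S. h (s f) = h f)}"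
  let ?lift = "\<lambda>k f. if f \<in> F then k (orbit_of F S f) else 0"
  have "bij_betw ?lift (vecs ?P) ?I"
    unfolding bij_betw_def
  proof
    show "inj_on ?lift (vecs ?P)"
    proof (rule inj_onI, rule ext)
      fix k l :: "nat set \<Rightarrow> bit" and c
      assume kl: "k \<in> vecs ?P" "l \<in> vecs ?P" and eq: "?lift k = ?lift l"
      show "k c = l c"
      proof (cases "c \<in> ?P")
        case True
        then obtain f where "f \<in> F" "c = orbit_of F S f" by blast
        then show ?thesis using fun_cong[OF eq, of f] by simp
      next
        case False
        then show ?thesis using kl unfolding vecs_def by simp
      qed
    qed
    show "?lift ` vecs ?P = ?I"
    proof (intro equalityI subsetI)
      fix h assume "h \<in> ?lift ` vecs ?P"
      then obtain k where h: "h = ?lift k" by blast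
      have "s f \<in> F" "orbit_of F S (s f) = orbit_of F S f" if "f \<in> F" "s \<in> S" for f s
        using S[OF that(2)] that orbit_of_eq[OF S that(1) orbit_of_step[OF orbit_of_refl]]
        by (auto simp: fpf_involution_on_def)
      then show "h \<in> ?I" unfolding h by simp
    next
      fix h assume h: "h \<in> ?I"
      have const: "h g = h f" if "f \<in> F" "g \<in> orbit_of F S f" for f g
      proof -
        have "orbit_of F S f \<subseteq> {g \<in> F. h g = h f}"
          by (rule orbit_of_least) (use h that S in \<open>auto simp: fpf_involution_on_def\<close>)
        then show ?thesis using that by blast
      qed
      \<comment> \<open>The representative picked is immaterial by \<open>const\<close>.\<close>
      define k where "k c = (if c \<in> ?P then h (SOME f. f \<in> c) else 0)" for c
      have "h = ?lift k"
      proof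
        fix f
        show "h f = ?lift k f"
        proof (cases "f \<in> F")
          case True
          have "(SOME g. g \<in> orbit_of F S f) \<in> orbit_of F S f"
            by (rule someI[of "\<lambda>g. g \<in> orbit_of F S f", OF orbit_of_refl])
          then show ?thesis using const True by (simp add: k_def)
        qed (use h in simp)
      qed
      moreover have "k \<in> vecs ?P" by (simp add: vecs_def k_def)
      ultimately show "h \<in> ?lift ` vecs ?P" by blast
    qed
  qed
  then have "card ?I = card (vecs ?P)" by (rule bij_betw_same_card[symmetric])
  then show ?thesis using card_vecs[of ?P] fin by simp
qed

text \<open>An alternating word of odd length in two involutions is a conjugate of one of them,
  hence has no fixed point either.\<close>

lemma involution_ne_funpow:
  assumes s: "fpf_involution_on F s" and t: "fpf_involution_on F t"
  shows "f \<in> F \<Longrightarrow> s f \<noteq> ((\<lambda>g. t (s g)) ^^ k) f"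
proof (induction k arbitrary: f rule: induct_nat_012)
  case (ge2 k)
  let ?r = "\<lambda>g. t (s g)"
  have cl: "s g \<in> F" "t g \<in> F" "s (s g) = g" "t (t g) = g" if "g \<in> F" for g
    using s t that by (auto simp: fpf_involution_on_def)
  have clr: "(?r ^^ m) g \<in> F" if "g \<in> F" for g m
    using that by (induction m) (auto simp: cl)
  show ?case
  proof
    assume eq: "s f = (?r ^^ Suc (Suc k)) f"
    have "(?r ^^ Suc (Suc k)) f = ?r ((?r ^^ k) (?r f))"
      using funpow_swap1[of ?r k f] by simp
    \<comment> \<open>Peeling off \<open>t\<close> and \<open>s\<close> on the left leaves the same
      kind of equation at \<open>t (s f)\<close>, with exponent \<open>k\<close> instead of
      \<open>k + 2\<close>.\<close>
    then have "s (t (s f)) = (?r ^^ k) (?r f)"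
      using eq cl clr[of "?r f" k] ge2.prems by metis
    then show False using ge2.IH(1)[of "?r f"] ge2.prems cl by simp
  qed
next
  case 1
  then show ?case using s t by (auto simp: fpf_involution_on_def) metis
qed (use s in \<open>auto simp: fpf_involution_on_def\<close>)

text \<open>The orbit consists of the iterates of the rotation \<open>t s\<close> at
  \<open>f\<close> and their images under \<open>s\<close>. These halves are disjoint by
  \<open>involution_ne_funpow\<close>, so the period of the rotation is half the size of the
  orbit.\<close>

lemma dihedral_orbit:
  assumes fin: "finite F" and s: "fpf_involution_on F s" and t: "fpf_involution_on F t"
    and f: "f \<in> F" and card: "card (orbit_of F {s, t} f) = 2 * m"
  shows "((\<lambda>g. t (s g)) ^^ m) f = f"
    and "inj_on (\<lambda>k. ((\<lambda>g. t (s g)) ^^ k) f) {..<m}"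
proof -
  let ?r = "\<lambda>g. t (s g)"
  define R where "R = (\<lambda>k. (?r ^^ k) f) ` UNIV"
  have cl: "s g \<in> F" "t g \<in> F" "s (s g) = g" "t (t g) = g" if "g \<in> F" for g
    using s t that by (auto simp: fpf_involution_on_def)
  have clr: "(?r ^^ k) g \<in> F" if "g \<in> F" for g k
    using that by (induction k) (auto simp: cl)
  have RF: "R \<subseteq> F" unfolding R_def using clr f by auto
  have funpow_plus: "(?r ^^ i) ((?r ^^ k) g) = (?r ^^ (i + k)) g" for i k g
    by (simp add: funpow_add)
  have inj_r: "inj_on ?r F" by (rule inj_onI) (metis cl)
  have inj_rk: "inj_on (?r ^^ k) F" for k
  proof (induction k)
    case (Suc k)
    have "(?r ^^ k) ` F \<subseteq> F" using clr by blast
    then have "inj_on (?r \<circ> ?r ^^ k) F"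
      using Suc inj_r by (intro comp_inj_on) (auto intro: inj_on_subset)
    then show ?case by (simp only: funpow.simps(2))
  qed simp
  have "finite R" using RF fin finite_subset by blast
  then have "\<not> inj (\<lambda>k. (?r ^^ k) f)"
    using finite_imageD[of "\<lambda>k. (?r ^^ k) f" "UNIV :: nat set"] unfolding R_def by auto
  then obtain i j where ij: "i < j" "(?r ^^ i) f = (?r ^^ j) f"
    by (metis (no_types, lifting) injI linorder_neqE_nat)
  have "(?r ^^ i) ((?r ^^ (j - i)) f) = (?r ^^ i) f"
    using ij by (simp add: funpow_plus)
  then have "(?r ^^ (j - i)) f = f"
    using inj_onD[OF inj_rk] clr f by blast
  with ij(1) have ex: "\<exists>p>0. (?r ^^ p) f = f" by (intro exI[of _ "j - i"]) simp
  \<comment> \<open>The exact period at \<open>f\<close>; it remains to see that the orbit has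
    \<open>2 * p\<close> elements.\<close>
  define p where "p = (LEAST p. p > 0 \<and> (?r ^^ p) f = f)"
  have p: "p > 0" "(?r ^^ p) f = f" and p_least: "\<And>q. q > 0 \<Longrightarrow> (?r ^^ q) f = f \<Longrightarrow> p \<le> q"
    using LeastI_ex[OF ex] unfolding p_def by (auto intro: Least_le)
  have inj_p: "inj_on (\<lambda>k. (?r ^^ k) f) {..<p}"
  proof (rule linorder_inj_onI)
    fix a b assume ab: "a < b" "a \<in> {..<p}" "b \<in> {..<p}"
    show "(?r ^^ a) f \<noteq> (?r ^^ b) f"
    proof
      assume "(?r ^^ a) f = (?r ^^ b) f"
      then have "(?r ^^ a) ((?r ^^ (b - a)) f) = (?r ^^ a) f"
        using ab by (simp add: funpow_plus)
      then have "(?r ^^ (b - a)) f = f"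
        using inj_onD[OF inj_rk] clr f by blast
      then show False using p_least[of "b - a"] ab by auto
    qed
  qed auto
  have "R = (\<lambda>k. (?r ^^ k) f) ` {..<p}"
    unfolding R_def using p funpow_mod_eq[of p ?r f] by (auto simp: image_iff) (metis lessThan_iff mod_less_divisor)
  then have card_R: "card R = p" using card_image[OF inj_p] by simp
  have r_R: "?r g \<in> R" if "g \<in> R" for g
    using that unfolding R_def by (auto intro: range_eqI[of _ _ "Suc _"])
  have "orbit_of F {s, t} f = R \<union> s ` R"
  proof
    show "orbit_of F {s, t} f \<subseteq> R \<union> s ` R"
    proof (rule orbit_of_least)
      show "f \<in> R \<union> s ` R" unfolding R_def by (auto intro: range_eqI[of _ _ 0])
      fix g u assume g: "g \<in> R \<union> s ` R" and u: "u \<in> {s, t}"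
      have t_R: "t h \<in> s ` R" if "h \<in> R" for h
      proof -
        obtain k where k: "h = (?r ^^ k) f" using \<open>h \<in> R\<close> unfolding R_def by blast
        \<comment> \<open>Adding the period makes the exponent positive, so that a last rotation can
          be split off even for \<open>k = 0\<close>.\<close>
        have "h = (?r ^^ (k + p)) f" using k p(2) by (simp add: funpow_add)
        then have "h = ?r ((?r ^^ (k + p - 1)) f)" using p(1)
          by (metis Suc_pred' add_gr_0 funpow.simps(2) comp_apply)
        then have "t h = s ((?r ^^ (k + p - 1)) f)" using cl clr f by simp
        then show ?thesis unfolding R_def by blast
      qed
      show "u g \<in> R \<union> s ` R"
      proof (cases "g \<in> R")
        case True
        then show ?thesis using u t_R by blast
      next
        case False
        then obtain h where h: "h \<in> R" "g = s h" using g by blast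
        have "h \<in> F" using RF h(1) by blast
        then have "s g \<in> R" unfolding h(2) using cl(3) h(1) by simp
        moreover have "t g \<in> R" unfolding h(2) by (rule r_R[OF h(1)])
        ultimately show ?thesis using u by blast
      qed
    qed
    have R_sub: "R \<subseteq> orbit_of F {s, t} f"
    proof -
      have "(?r ^^ k) f \<in> orbit_of F {s, t} f" for k
      proof (induction k)
        case (Suc k)
        have in_F: "(?r ^^ k) f \<in> F" by (rule clr[OF f])
        have "s ((?r ^^ k) f) \<in> orbit_of F {s, t} f"
          using orbit_of_step[OF Suc in_F, of s] by simp
        then have "t (s ((?r ^^ k) f)) \<in> orbit_of F {s, t} f"
          using orbit_of_step[of "s ((?r ^^ k) f)" F "{s, t}" f t] cl(1)[OF in_F] by simp
        then show ?case by simp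
      qed (simp add: orbit_of_refl)
      then show ?thesis unfolding R_def by blast
    qed
    moreover have "s g \<in> orbit_of F {s, t} f" if "g \<in> R" for g
      using orbit_of_step[of g F "{s, t}" f s] that R_sub RF by blast
    ultimately show "R \<union> s ` R \<subseteq> orbit_of F {s, t} f" by blast
  qed
  moreover have "R \<inter> s ` R = {}"
  proof (rule ccontr)
    assume "R \<inter> s ` R \<noteq> {}"
    then obtain a b where ab: "(?r ^^ a) f = s ((?r ^^ b) f)" unfolding R_def by blast
    \<comment> \<open>Here \<open>b * (p - 1)\<close> further rotations undo \<open>b\<close> of
      them, which exhibits \<open>s\<close> of a point as a rotation of the same point.\<close>
    have "(?r ^^ (a + b * (p - 1))) ((?r ^^ b) f) = (?r ^^ a) ((?r ^^ (b * p)) f)"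
      using p(1) by (cases p) (simp_all add: funpow_plus algebra_simps)
    also have "(?r ^^ (b * p)) f = f"
      using funpow_mod_eq[OF p(2), of "b * p"] by simp
    finally have "s ((?r ^^ b) f) = (?r ^^ (a + b * (p - 1))) ((?r ^^ b) f)" using ab by simp
    then show False using involution_ne_funpow[OF s t] clr f by blast
  qed
  moreover have "card (s ` R) = card R"
    using RF by (intro card_image inj_onI) (metis cl(3) subsetD)
  ultimately have "card (orbit_of F {s, t} f) = 2 * p"
    using \<open>finite R\<close> by (simp add: card_Un_disjoint card_R)
  then have "m = p" using card by simp
  show "(?r ^^ m) f = f" unfolding \<open>m = p\<close> by (rule p(2))
  show "inj_on (\<lambda>k. (?r ^^ k) f) {..<m}" unfolding \<open>m = p\<close> by (rule inj_p)
qed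

section \<open>Maps in normal form\<close>

lemma card_UNIV_bool_pair: "card (UNIV :: (bool \<times> bool) set) = 4"
  by (simp flip: UNIV_Times_UNIV add: card_cartesian_product)

text \<open>The flag \<open>\<psi> i s e\<close> lies on the side \<open>s\<close> of the path at its \<open>i\<close>-th visit to a vertex,
  on the outgoing edge if \<open>e\<close> and on the incoming edge otherwise. The colour of a symbol
  tells on which side the corners pair the two incoming and the two outgoing edges.\<close>

locale coded_map =
  fixes X :: "'a list" and F :: "nat set" and s0 s1 s2 :: "nat \<Rightarrow> nat"
    and \<psi> :: "nat \<Rightarrow> bool \<Rightarrow> bool \<Rightarrow> nat" and col :: "'a \<Rightarrow> bool"
  assumes code: "gauss_code X" and nonempty: "X \<noteq> []"
    and flags: "F = {\<psi> i s e | i s e. i < length X}"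
    and inj: "\<And>i j s s' e e'. \<lbrakk>i < length X; j < length X; \<psi> i s e = \<psi> j s' e'\<rbrakk>
      \<Longrightarrow> i = j \<and> s = s' \<and> e = e'"
    and period: "\<And>i s e. \<psi> (i + length X) s e = \<psi> i s e"
    and s0_out: "\<And>i s. s0 (\<psi> i s True) = \<psi> (Suc i) s False"
    and s0_in: "\<And>i s. s0 (\<psi> (Suc i) s False) = \<psi> i s True"
    and s2_psi: "\<And>i s e. s2 (\<psi> i s e) = \<psi> i (\<not> s) e"
    and s1_psi: "\<And>i j s e. \<lbrakk>i < length X; j < length X; i \<noteq> j; X ! i = X ! j\<rbrakk>
      \<Longrightarrow> s1 (\<psi> i s e) = \<psi> j s (e = (s = col (X ! i)))"
begin

lemma length_pos: "length X > 0"
  using nonempty by simp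

lemma psi_add_mult: "\<psi> (i + m * length X) s e = \<psi> i s e"
proof (induction m)
  case (Suc m)
  then show ?case using period[of "i + m * length X"] by (simp add: ac_simps)
qed simp

lemma psi_mod: "\<psi> (i mod length X) s e = \<psi> i s e"
  using psi_add_mult[of "i mod length X" "i div length X"] by simp

lemma psi_in: "\<psi> i s e \<in> F"
proof -
  have "i mod length X < length X" using length_pos by simp
  then have "\<psi> (i mod length X) s e \<in> F" unfolding flags by blast
  then show ?thesis by (simp only: psi_mod)
qed

lemma psi_eq_iff: "\<psi> i s e = \<psi> j s' e' \<longleftrightarrow> i mod length X = j mod length X \<and> s = s' \<and> e = e'"
proof
  assume "\<psi> i s e = \<psi> j s' e'"
  then have "\<psi> (i mod length X) s e = \<psi> (j mod length X) s' e'" by (simp only: psi_mod)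
  then show "i mod length X = j mod length X \<and> s = s' \<and> e = e'"
    by (rule inj[rotated 2]) (use length_pos in simp_all)
next
  assume "i mod length X = j mod length X \<and> s = s' \<and> e = e'"
  then show "\<psi> i s e = \<psi> j s' e'"
    using psi_mod[of i s e] psi_mod[of j s e] by simp
qed

lemma flag_cases:
  assumes "f \<in> F"
  obtains i s e where "i < length X" "f = \<psi> i s e"
  using assms unfolding flags by blast

text \<open>The equations for \<open>s0\<close> link outgoing flags at \<open>i\<close> with
  incoming flags at \<open>Suc i\<close>. By periodicity every incoming index, including 0, may be
  taken to be a successor.\<close>

lemma flag_cases_Suc:
  assumes "f \<in> F"
  obtains (out) i s where "f = \<psi> i s True" | (into) i s where "f = \<psi> (Suc i) s False"
proof -
  obtain i s e where f: "f = \<psi> i s e" using assms by (rule flag_cases)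
  have f': "f = \<psi> (Suc (i + length X - 1)) s e"
    using period[of i s e] length_pos f by simp
  show ?thesis
  proof (cases e)
    case True
    then show ?thesis using f out by simp
  next
    case False
    then have "f = \<psi> (Suc (i + length X - 1)) s False" using f' by simp
    then show ?thesis by (rule into)
  qed
qed

lemma finite_flags: "finite F" and card_flags: "card F = 4 * length X"
proof -
  have F: "F = (\<lambda>(i, s, e). \<psi> i s e) ` ({..<length X} \<times> UNIV \<times> UNIV)"
    unfolding flags by (auto simp: image_iff) blast
  show "finite F" unfolding F by simp
  have "inj_on (\<lambda>(i, s, e). \<psi> i s e) ({..<length X} \<times> UNIV \<times> UNIV)"
    by (auto simp: inj_on_def psi_eq_iff)
  then show "card F = 4 * length X"
    unfolding F by (simp add: card_image card_cartesian_product card_UNIV_bool_pair)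
qed

lemma partner:
  assumes "i < length X"
  obtains j where "j < length X" "j \<noteq> i" "X ! j = X ! i"
    "\<And>s e. s1 (\<psi> i s e) = \<psi> j s (e = (s = col (X ! i)))"
    "\<And>s e. s1 (\<psi> j s e) = \<psi> i s (e = (s = col (X ! i)))"
proof -
  obtain j where j: "j < length X" "j \<noteq> i" "X ! j = X ! i"
    using other_occurrence[OF code assms] by metis
  show ?thesis
    by (rule that[OF j]) (use s1_psi[of i j] s1_psi[of j i] j assms in simp_all)
qed

section \<open>Map axioms and smooth path in normal form\<close>

lemma involution_s0: "fpf_involution_on F s0"
  unfolding fpf_involution_on_def
proof
  fix f assume "f \<in> F"
  then show "s0 f \<in> F \<and> s0 (s0 f) = f \<and> s0 f \<noteq> f"
    by (cases rule: flag_cases_Suc) (simp_all add: s0_out s0_in psi_in psi_eq_iff)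
qed

lemma involution_s2: "fpf_involution_on F s2"
  unfolding fpf_involution_on_def
proof
  fix f assume "f \<in> F"
  then show "s2 f \<in> F \<and> s2 (s2 f) = f \<and> s2 f \<noteq> f"
    by (cases rule: flag_cases) (simp_all add: s2_psi psi_in psi_eq_iff)
qed

lemma involution_s1: "fpf_involution_on F s1"
  unfolding fpf_involution_on_def
proof
  fix f assume "f \<in> F"
  then obtain i s e where i: "i < length X" and f: "f = \<psi> i s e" by (rule flag_cases)
  from i obtain j where j: "j < length X" "j \<noteq> i"
    and s1: "\<And>s e. s1 (\<psi> i s e) = \<psi> j s (e = (s = col (X ! i)))"
      "\<And>s e. s1 (\<psi> j s e) = \<psi> i s (e = (s = col (X ! i)))"
    by (rule partner) blast
  show "s1 f \<in> F \<and> s1 (s1 f) = f \<and> s1 f \<noteq> f"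
    unfolding f s1 using i j by (auto simp: psi_in psi_eq_iff)
qed

lemmas involutions = involution_s0 involution_s1 involution_s2

text \<open>The two applications of \<open>s1\<close> lead to the other occurrence and back, on
  opposite sides of the path. Exactly one of them exchanges incoming and outgoing, so turning by two
  reverses \<open>e\<close>.\<close>

lemma smooth_step_psi: "smooth_step s0 s1 s2 (\<psi> i s e) = s0 (\<psi> i s (\<not> e))"
proof -
  let ?i = "i mod length X"
  have "?i < length X" using length_pos by simp
  then obtain j where
    s1: "\<And>s e. s1 (\<psi> ?i s e) = \<psi> j s (e = (s = col (X ! ?i)))"
      "\<And>s e. s1 (\<psi> j s e) = \<psi> ?i s (e = (s = col (X ! ?i)))"
    by (rule partner) blast
  have "smooth_step s0 s1 s2 (\<psi> ?i s e) = s0 (\<psi> ?i s (\<not> e))"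
    unfolding smooth_step_def s1 s2_psi by (rule arg_cong[where f = s0]) (auto simp: psi_eq_iff)
  then show ?thesis by (simp add: psi_mod)
qed

lemma smooth_step_in: "smooth_step s0 s1 s2 (\<psi> i s False) = \<psi> (Suc i) s False"
  by (simp add: smooth_step_psi s0_out)

lemma smooth_step_funpow: "(smooth_step s0 s1 s2 ^^ k) (\<psi> i s False) = \<psi> (i + k) s False"
  by (induction k) (simp_all add: smooth_step_in)

lemma one_smooth_path: "one_smooth_path F s0 s1 s2"
  unfolding one_smooth_path_def
proof
  let ?S = "{smooth_step s0 s1 s2, s0, s2}"
  fix f assume f: "f \<in> F"
  define R where "R = orbit_of F ?S f"
  have step: "u g \<in> R" if "g \<in> R" "g \<in> F" "u \<in> ?S" for g u
    using orbit_of_step[of g F ?S f u] that unfolding R_def by blast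
  obtain k s where k: "\<psi> k s False \<in> R"
    using f
  proof (cases rule: flag_cases_Suc)
    case (out i s)
    have "s0 f \<in> R" using step orbit_of_refl f unfolding R_def by blast
    then show ?thesis using out that s0_out by simp
  next
    case (into i s)
    then show ?thesis using that orbit_of_refl unfolding R_def by blast
  qed
  have "\<psi> (k + m) s False \<in> R" for m
  proof (induction m)
    case (Suc m)
    then show ?case using step[of "\<psi> (k + m) s False" "smooth_step s0 s1 s2"]
      by (simp add: psi_in smooth_step_in)
  qed (use k in simp)
  then have into: "\<psi> (k + m) s' False \<in> R" for m s'
    using step[of "\<psi> (k + m) s False" s2] by (cases "s' = s") (auto simp: psi_in s2_psi)
  have all_in: "\<psi> j s' False \<in> R" for j s'
  proof -
    \<comment> \<open>Adding \<open>k\<close> full turns to \<open>j\<close> makes it reachable from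
      \<open>k\<close> by a nonnegative number of steps.\<close>
    have "k \<le> j + k * length X" using length_pos by (cases "length X") (auto intro: trans_le_add2)
    then show ?thesis
      using into[of "j + k * length X - k" s'] by (simp add: psi_add_mult)
  qed
  have all_out: "\<psi> j s' True \<in> R" for j s'
    using step[OF all_in[of "Suc j" s'], of s0] by (simp add: psi_in s0_in)
  have "F \<subseteq> R"
  proof
    fix g assume "g \<in> F"
    then obtain j s' e where "g = \<psi> j s' e" by (rule flag_cases)
    then show "g \<in> R" using all_in all_out by (cases e) simp_all
  qed
  moreover have "R \<subseteq> F"
    unfolding R_def
  proof (rule orbit_of_least[OF f])
    fix g u assume g: "g \<in> F" and u: "u \<in> ?S"
    have "u g \<in> F" if "u \<in> {s0, s2}"
      using involutions that g by (auto simp: fpf_involution_on_def)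
    moreover have "smooth_step s0 s1 s2 g \<in> F"
      unfolding smooth_step_def using involutions g by (auto simp: fpf_involution_on_def)
    ultimately show "u g \<in> F" using u by blast
  qed
  ultimately show "orbit_of F ?S f = F" unfolding R_def by blast
qed

lemma is_map: "is_map F s0 s1 s2"
  unfolding is_map_def
proof (intro conjI ballI)
  show "F \<noteq> {}" using psi_in by blast
next
  fix f assume f: "f \<in> F"
  then show "s0 (s2 f) = s2 (s0 f)"
    by (cases rule: flag_cases_Suc) (simp_all add: s0_out s0_in s2_psi)
  show "s0 (s2 f) \<noteq> f" using f
    by (cases rule: flag_cases_Suc) (simp_all add: s0_out s0_in s2_psi psi_eq_iff)
  have inv: "\<And>u. u \<in> {s0, s1, s2} \<Longrightarrow> fpf_involution_on F u" using involutions by blast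
  \<comment> \<open>The smooth step is a word in the three involutions, so transitivity is inherited
    from the single smooth path.\<close>
  have "F = orbit_of F {smooth_step s0 s1 s2, s0, s2} f"
    using one_smooth_path f unfolding one_smooth_path_def by simp
  also have "\<dots> \<subseteq> F \<inter> orbit_of F {s0, s1, s2} f"
  proof (rule orbit_of_least)
    fix g u assume g: "g \<in> F \<inter> orbit_of F {s0, s1, s2} f" and u: "u \<in> {smooth_step s0 s1 s2, s0, s2}"
    have step: "v h \<in> F \<inter> orbit_of F {s0, s1, s2} f"
      if "h \<in> F \<inter> orbit_of F {s0, s1, s2} f" "v \<in> {s0, s1, s2}" for h v
      using that inv[OF that(2)] orbit_of_step[of h F _ f v] by (auto simp: fpf_involution_on_def)
    have steps: "s0 h \<in> F \<inter> orbit_of F {s0, s1, s2} f" "s1 h \<in> F \<inter> orbit_of F {s0, s1, s2} f"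
        "s2 h \<in> F \<inter> orbit_of F {s0, s1, s2} f" if "h \<in> F \<inter> orbit_of F {s0, s1, s2} f" for h
      using step[OF that] by blast+
    have "smooth_step s0 s1 s2 g \<in> F \<inter> orbit_of F {s0, s1, s2} f"
      unfolding smooth_step_def by (intro steps g)
    then show "u g \<in> F \<inter> orbit_of F {s0, s1, s2} f" using u steps[OF g] by blast
  qed (use f orbit_of_refl in blast)
  finally show "orbit_of F {s0, s1, s2} f = F" using orbit_of_subset[OF inv f] by blast
qed (use finite_flags involutions in simp_all)

lemma four_regular: "four_regular F s0 s1 s2"
  unfolding four_regular_def
proof
  fix f assume "f \<in> F"
  then obtain i s e where i: "i < length X" and f: "f = \<psi> i s e" by (rule flag_cases)
  from i obtain j where j: "j < length X" "j \<noteq> i"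
    and s1: "\<And>s e. s1 (\<psi> i s e) = \<psi> j s (e = (s = col (X ! i)))"
      "\<And>s e. s1 (\<psi> j s e) = \<psi> i s (e = (s = col (X ! i)))"
    by (rule partner) blast
  let ?O = "(\<lambda>(k, s, e). \<psi> k s e) ` ({i, j} \<times> UNIV \<times> UNIV)"
  define R where "R = orbit_of F {s1, s2} f"
  have "R \<subseteq> ?O"
    unfolding R_def by (rule orbit_of_least) ((auto simp: f s1 s2_psi image_iff), blast+)
  moreover have "?O \<subseteq> R"
  proof -
    have step: "u g \<in> R" if "g \<in> R" "g \<in> F" "u \<in> {s1, s2}" for g u
      using orbit_of_step[of g F "{s1, s2}" f u] that unfolding R_def by blast
    have a: "\<psi> k (\<not> s') e' \<in> R" if "\<psi> k s' e' \<in> R" for k s' e'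
      using step[OF that psi_in, of s2] by (simp add: s2_psi)
    have b: "\<psi> j s' (e' = (s' = col (X ! i))) \<in> R" if "\<psi> i s' e' \<in> R" for s' e'
      using step[OF that psi_in, of s1] by (simp add: s1)
    have c: "\<psi> i s' (e' = (s' = col (X ! i))) \<in> R" if "\<psi> j s' e' \<in> R" for s' e'
      using step[OF that psi_in, of s1] by (simp add: s1)
    have 1: "\<psi> i s e \<in> R" using orbit_of_refl f unfolding R_def by simp
    have 2: "\<psi> i (\<not> s) e \<in> R" using a[OF 1] .
    \<comment> \<open>Going to the other occurrence, changing sides and returning flips both side
      and direction.\<close>
    have 3: "\<psi> i (\<not> s) (\<not> e) \<in> R"
      using c[OF a[OF b[OF 1]]] by (cases e; cases s; cases "col (X ! i)") simp_all
    have 4: "\<psi> i s (\<not> e) \<in> R" using a[OF 3] by simp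
    have i_R: "\<psi> i s' e' \<in> R" for s' e'
      using 1 2 3 4 by (cases "s' = s"; cases "e' = e") simp_all
    have "\<psi> j s' e' \<in> R" for s' e'
      using b[OF i_R[of s' "e' = (s' = col (X ! i))"]] by (cases e'; cases "s' = col (X ! i)") simp_all
    then show ?thesis using i_R by auto
  qed
  ultimately have "R = ?O" by blast
  moreover have "card ?O = 8"
  proof -
    have "inj_on (\<lambda>(k, s, e). \<psi> k s e) ({i, j} \<times> UNIV \<times> UNIV)"
      using i j by (auto simp: inj_on_def psi_eq_iff)
    then show ?thesis using j by (simp add: card_image card_cartesian_product card_UNIV_bool_pair)
  qed
  ultimately show "card (orbit_of F {s1, s2} f) = 8" unfolding R_def by simp
qed

lemma faces_two_colourable: "faces_two_colourable F s0 s1 s2"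
proof -
  \<comment> \<open>Faces are coloured by the side of the path on which they lie.\<close>
  define c where "c f = (\<exists>i e. f = \<psi> i True e)" for f
  have c: "c (\<psi> i s e) = s" for i s e
    unfolding c_def by (cases s) (auto simp: psi_eq_iff)
  have "c (s0 f) = c f \<and> c (s1 f) = c f \<and> c (s2 f) \<noteq> c f" if "f \<in> F" for f
  proof (intro conjI)
    show "c (s0 f) = c f" using that
      by (cases rule: flag_cases_Suc) (simp_all add: s0_out s0_in c)
    obtain i s e where i: "i < length X" and f: "f = \<psi> i s e" using \<open>f \<in> F\<close> by (rule flag_cases)
    show "c (s1 f) = c f" using i by (rule partner) (simp add: f c)
    show "c (s2 f) \<noteq> c f" by (simp add: f c s2_psi)
  qed
  then show ?thesis unfolding faces_two_colourable_def by blast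
qed

lemma realizes:
  assumes \<phi>: "\<And>i s e. i < length X \<Longrightarrow> \<phi> (\<psi> i s e) = X ! i"
  shows "realizes X F s0 s1 s2 \<phi>"
proof -
  have \<phi>_mod: "\<phi> (\<psi> i s e) = X ! (i mod length X)" for i s e
    using \<phi>[of "i mod length X" s e] length_pos by (simp add: psi_mod)
  have const: "\<phi> (s1 f) = \<phi> f \<and> \<phi> (s2 f) = \<phi> f" if f: "f \<in> F" for f
  proof
    obtain i s e where i: "i < length X" and f: "f = \<psi> i s e" using \<open>f \<in> F\<close> by (rule flag_cases)
    show "\<phi> (s1 f) = \<phi> f" using i by (rule partner) (simp add: f \<phi> i)
    show "\<phi> (s2 f) = \<phi> f" by (simp add: f s2_psi \<phi>_mod)
  qed
  have inj_vertex: "g \<in> orbit_of F {s1, s2} f" if "f \<in> F" "g \<in> F" and eq: "\<phi> f = \<phi> g" for f g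
  proof -
    obtain i s e where i: "i < length X" and f: "f = \<psi> i s e" using \<open>f \<in> F\<close> by (rule flag_cases)
    obtain j s' e' where j: "j < length X" and g: "g = \<psi> j s' e'" using \<open>g \<in> F\<close> by (rule flag_cases)
    have ij: "X ! i = X ! j" using eq i j by (simp add: f g \<phi>)
    let ?A = "{g \<in> F. \<phi> g = \<phi> f}"
    have sub: "orbit_of F {s1, s2} f \<subseteq> ?A"
      by (rule orbit_of_least)
        (use \<open>f \<in> F\<close> const involutions in \<open>auto simp: fpf_involution_on_def\<close>)
    obtain k where k: "k < length X" "k \<noteq> i" "X ! k = X ! i"
      and only: "\<And>l. l < length X \<Longrightarrow> X ! l = X ! i \<Longrightarrow> l = i \<or> l = k"
      using other_occurrence[OF code i] by metis
    have "?A \<subseteq> (\<lambda>(k, s, e). \<psi> k s e) ` ({i, k} \<times> UNIV \<times> UNIV)"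
    proof
      fix h assume h: "h \<in> ?A"
      then obtain l t d where l: "l < length X" and h_eq: "h = \<psi> l t d" by (auto elim: flag_cases)
      then have "l = i \<or> l = k" using h i only by (simp add: f \<phi>)
      then show "h \<in> (\<lambda>(k, s, e). \<psi> k s e) ` ({i, k} \<times> UNIV \<times> UNIV)"
        unfolding h_eq by (auto simp: image_iff)
    qed
    \<comment> \<open>The flags labelled like \<open>f\<close> number at most eight and include the
      vertex orbit, which already has eight.\<close>
    then have "card ?A \<le> card ((\<lambda>(k, s, e). \<psi> k s e) ` ({i, k} \<times> (UNIV::bool set) \<times> (UNIV::bool set)))"
      by (intro card_mono) simp_all
    also have "\<dots> \<le> card ({i, k} \<times> (UNIV::bool set) \<times> (UNIV::bool set))"
      by (rule card_image_le) simp
    also have "\<dots> = 8" using k by (simp add: card_cartesian_product card_UNIV_bool_pair)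
    also have "\<dots> = card (orbit_of F {s1, s2} f)"
      using four_regular \<open>f \<in> F\<close> by (simp add: four_regular_def)
    finally have "orbit_of F {s1, s2} f = ?A"
      using sub finite_flags by (intro card_seteq) auto
    then show ?thesis using \<open>g \<in> F\<close> eq by simp
  qed
  have onto: "\<phi> ` F = set X"
  proof
    show "\<phi> ` F \<subseteq> set X" using \<phi> by (auto elim!: flag_cases)
    show "set X \<subseteq> \<phi> ` F"
    proof
      fix p assume "p \<in> set X"
      then obtain i where "i < length X" "X ! i = p" by (auto simp: in_set_conv_nth)
      then show "p \<in> \<phi> ` F" using \<phi>[of i True True] psi_in by (metis image_eqI)
    qed
  qed
  have path: "\<phi> ((smooth_step s0 s1 s2 ^^ k) (\<psi> 0 True False)) = X ! (k mod length X)" for k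
    by (simp add: smooth_step_funpow \<phi>_mod)
  show ?thesis unfolding realizes_def
    by (intro conjI ballI impI allI bexI[of _ "\<psi> 0 True False"])
      (simp_all add: const inj_vertex onto path psi_in)
qed

section \<open>Counting vertices, edges and faces\<close>

lemma card_vertices: "card (map_vertices F s0 s1 s2) = card (set X)"
proof -
  have "8 * card (map_vertices F s0 s1 s2) = card F"
    unfolding map_vertices_def
    by (rule card_orbits) (use finite_flags involutions four_regular in \<open>auto simp: four_regular_def\<close>)
  then show ?thesis using card_flags length_gauss_code[OF code] by simp
qed

lemma card_edges: "card (map_edges F s0 s1 s2) = length X"
proof -
  have "card (orbit_of F {s0, s2} f) = 4" if f: "f \<in> F" for f
  proof -
    have comm: "s0 (s2 g) = s2 (s0 g)" "s0 (s2 g) \<noteq> g" if "g \<in> F" for g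
      using is_map that unfolding is_map_def by blast+
    have inv: "s0 g \<in> F" "s2 g \<in> F" "s0 (s0 g) = g" "s2 (s2 g) = g" "s0 g \<noteq> g" "s2 g \<noteq> g"
      if "g \<in> F" for g
      using involutions that by (simp_all add: fpf_involution_on_def)
    have "orbit_of F {s0, s2} f = {f, s0 f, s2 f, s0 (s2 f)}"
    proof
      show "orbit_of F {s0, s2} f \<subseteq> {f, s0 f, s2 f, s0 (s2 f)}"
        by (rule orbit_of_least) (use f in \<open>auto simp: inv comm(1)\<close>)
      show "{f, s0 f, s2 f, s0 (s2 f)} \<subseteq> orbit_of F {s0, s2} f"
        using f inv orbit_of_refl[of f F "{s0, s2}"] orbit_of_step[of f F "{s0, s2}" f s0]
          orbit_of_step[of f F "{s0, s2}" f s2] orbit_of_step[of "s2 f" F "{s0, s2}" f s0] by simp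
    qed
    moreover have "card {f, s0 f, s2 f, s0 (s2 f)} = 4"
    proof -
      have "s0 f \<noteq> s2 f" using comm[OF f] inv f by metis
      moreover have "s0 f \<noteq> s0 (s2 f)" using inv f by metis
      moreover have "s0 (s2 f) \<noteq> s2 f" "s0 f \<noteq> f" "s2 f \<noteq> f" using inv f by metis+
      ultimately show ?thesis using comm(2)[OF f] by (simp add: card_insert_if eq_commute)
    qed
    ultimately show ?thesis by simp
  qed
  then have "4 * card (map_edges F s0 s1 s2) = card F"
    unfolding map_edges_def
    by (intro card_orbits) (use finite_flags involutions in auto)
  then show ?thesis using card_flags by simp
qed

text \<open>A function constant on faces is determined by its values on incoming flags, as
  \<open>s0\<close> matches these with the outgoing ones. Faces lie on one side of the path, so the
  two sides yield independent gap functions.\<close>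

lemma card_faces:
  "2 ^ card (map_faces F s0 s1 s2) =
    card (gap_funs X (\<lambda>p. True = col p)) * card (gap_funs X (\<lambda>p. False = col p))"
proof -
  let ?I = "{h :: nat \<Rightarrow> bit. (\<forall>f. f \<notin> F \<longrightarrow> h f = 0) \<and> (\<forall>f\<in>F. \<forall>s\<in>{s0, s1}. h (s f) = h f)}"
  let ?G = "\<lambda>s. gap_funs X (\<lambda>p. s = col p)"
  let ?r = "\<lambda>h. (\<lambda>i. h (\<psi> i True False), \<lambda>i. h (\<psi> i False False))"
  have out: "h (\<psi> i s True) = h (\<psi> (Suc i) s False)" if "h \<in> ?I" for h i s
    using that psi_in[of i s True] s0_out[of i s] by auto
  have bij: "bij_betw ?r ?I (?G True \<times> ?G False)"
    unfolding bij_betw_def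
  proof
    show "inj_on ?r ?I"
    proof (rule inj_onI, rule ext)
      fix h k f assume hk: "h \<in> ?I" "k \<in> ?I" and eq: "?r h = ?r k"
      have in_eq: "h (\<psi> i s False) = k (\<psi> i s False)" for i s
        using eq by (cases s) (auto dest: fun_cong)
      show "h f = k f"
      proof (cases "f \<in> F")
        case True
        then show ?thesis
          by (cases rule: flag_cases_Suc) (simp_all add: in_eq out[OF hk(1)] out[OF hk(2)])
      qed (use hk in simp)
    qed
    show "?r ` ?I = ?G True \<times> ?G False"
    proof (intro equalityI subsetI)
      fix z assume "z \<in> ?r ` ?I"
      then obtain h where h: "h \<in> ?I" and z: "z = ?r h" by blast
      have "(\<lambda>i. h (\<psi> i s False)) \<in> ?G s" for s
        unfolding gap_funs_def
      proof (intro CollectI conjI allI impI)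
        fix i j assume ij: "i < length X" "j < length X" "i \<noteq> j" "X ! i = X ! j"
        have "h (\<psi> j s (e = (s = col (X ! i)))) = h (\<psi> i s e)" for e
          using h psi_in[of i s e] s1_psi[OF ij, of s e] by auto
        from this[of True] this[of False]
        show "if s = col (X ! i) then h (\<psi> i s False) = h (\<psi> j s False) \<and>
            h (\<psi> (Suc i) s False) = h (\<psi> (Suc j) s False)
          else h (\<psi> (Suc i) s False) = h (\<psi> j s False) \<and>
            h (\<psi> i s False) = h (\<psi> (Suc j) s False)"
          by (cases "s = col (X ! i)") (simp_all add: out[OF h])
      qed (simp add: period)
      then show "z \<in> ?G True \<times> ?G False" unfolding z by blast
    next
      fix z assume "z \<in> ?G True \<times> ?G False"
      then obtain gT gF where z: "z = (gT, gF)" "gT \<in> ?G True" "gF \<in> ?G False" by blast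
      define g where "g s = (if s then gT else gF)" for s
      have g: "g s \<in> ?G s" for s using z by (cases s) (simp_all add: g_def)
      then have g_add: "g s (i + length X) = g s i" for s i
        by (simp add: gap_funs_def)
      have g_mult: "g s (i + m * length X) = g s i" for s i m
      proof (induction m)
        case (Suc m)
        then show ?case using g_add[of s "i + m * length X"] by (simp add: ac_simps)
      qed simp
      have g_mod: "g s (i mod length X) = g s i" "g s (Suc (i mod length X)) = g s (Suc i)" for s i
        using g_mult[of s "i mod length X" "i div length X"]
          g_mult[of s "Suc (i mod length X)" "i div length X"] by simp_all
      \<comment> \<open>The outgoing edge at position \<open>i\<close> is gap
        \<open>Suc i\<close>.\<close>
      define v where "v i s e = g s (if e then Suc i else i)" for i s e
      \<comment> \<open>A flag fixes its index only modulo the length; \<open>v_eq\<close> makes the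
        described value unique.\<close>
      define h where "h f = (if f \<in> F then THE b. \<exists>i s e. f = \<psi> i s e \<and> b = v i s e else 0)" for f
      have v_eq: "v i s e = v j s' e'" if "\<psi> i s e = \<psi> j s' e'" for i j s s' e e'
      proof -
        have v_mod: "v (i mod length X) s e = v i s e" for i s e
          using g_mod[of s i] by (simp add: v_def)
        have "i mod length X = j mod length X" "s = s'" "e = e'"
          using that by (simp_all add: psi_eq_iff)
        then show ?thesis using v_mod[of i s e] v_mod[of j s e] by simp
      qed
      have h: "h (\<psi> i s e) = v i s e" for i s e
      proof -
        have "h (\<psi> i s e) = (THE b. \<exists>i' s' e'. \<psi> i s e = \<psi> i' s' e' \<and> b = v i' s' e')"
          using psi_in[of i s e] by (simp add: h_def)
        also have "\<dots> = v i s e"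
        proof (rule the_equality)
          fix b assume "\<exists>i' s' e'. \<psi> i s e = \<psi> i' s' e' \<and> b = v i' s' e'"
          then obtain i' s' e' where "\<psi> i s e = \<psi> i' s' e'" "b = v i' s' e'" by blast
          then show "b = v i s e" using v_eq[of i s e i' s' e'] by simp
        qed blast
        finally show ?thesis .
      qed
      have "h \<in> ?I"
      proof (intro CollectI conjI allI impI ballI)
        fix f u assume f: "f \<in> F" and u: "u \<in> {s0, s1}"
        have "h (s0 f) = h f" using f
          by (cases rule: flag_cases_Suc) (simp_all add: h s0_out s0_in v_def)
        moreover have "h (s1 f) = h f"
        proof -
          obtain i s e where i: "i < length X" and f_eq: "f = \<psi> i s e" using f by (rule flag_cases)
          obtain j where j: "j < length X" "j \<noteq> i" "X ! j = X ! i"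
            using other_occurrence[OF code i] by metis
          have "if s = col (X ! i) then g s i = g s j \<and> g s (Suc i) = g s (Suc j)
              else g s (Suc i) = g s j \<and> g s i = g s (Suc j)"
            using gap_funsD[OF g[of s] i j(1) j(2)[symmetric] j(3)[symmetric]] .
          then show ?thesis
            unfolding f_eq s1_psi[OF i j(1) j(2)[symmetric] j(3)[symmetric]] h v_def
            by (cases e) (auto split: if_splits)
        qed
        ultimately show "h (u f) = h f" using u by blast
      qed (simp add: h_def)
      moreover have "?r h = z" by (simp add: h v_def g_def z)
      ultimately show "z \<in> ?r ` ?I" by blast
    qed
  qed
  have "2 ^ card (map_faces F s0 s1 s2) = card ?I"
    unfolding map_faces_def
    by (rule card_invariant_funs[symmetric]) (use finite_flags involutions in auto)
  also have "\<dots> = card (?G True \<times> ?G False)" using bij by (rule bij_betw_same_card)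
  finally show ?thesis by (simp add: card_cartesian_product card_UNIV_bool_pair)
qed

end

section \<open>The connectivity as a rank\<close>

context coded_map
begin

lemma connectivity_le_1_iff:
  "map_connectivity F s0 s1 s2 \<le> 1 \<longleftrightarrow> (\<forall>y\<in>set X. \<forall>z\<in>set X.
     odd (card (interlaced_set X y \<inter> interlaced_set X z)
          + card (interlaced_set X y) * card (interlaced_set X z))
     \<longleftrightarrow> (interlaced X y z \<and> col y = col z))"
proof -
  \<comment> \<open>The matrices belong to the two sides of the path; their diagonal bits are
    complementary, so \<open>?C\<close> is \<open>?B\<close> plus the identity.\<close>
  let ?S = "set X" and ?B = "interlace_mat X col" and ?C = "interlace_mat X (\<lambda>p. \<not> col p)"
  define n f where "n = card ?S" and "f = card (map_faces F s0 s1 s2)"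
  define M where "M p q = (\<Sum>r\<in>?S. ?B p r * ?B r q) + ?B p q" for p q
  have "card (mat_ker ?S ?B) * card (mat_ker ?S ?C) = card (mat_ker ?S M)"
  proof (rule card_mat_ker_times)
    show "mat_vec ?S ?C x p = mat_vec ?S ?B x p + x p" if "x \<in> vecs ?S" for x p
    proof (cases "p \<in> ?S")
      case True
      then show ?thesis by (simp add: mat_vec_interlace add.assoc)
    next
      case False
      then show ?thesis using that by (simp add: mat_vec_def vecs_def)
    qed
    show "mat_vec ?S M x p = mat_vec ?S ?B (mat_vec ?S ?B x) p + mat_vec ?S ?B x p" for x p
    proof (cases "p \<in> ?S")
      case True
      have "(\<Sum>r\<in>?S. ?B p r * (\<Sum>q\<in>?S. ?B r q * x q)) = (\<Sum>r\<in>?S. \<Sum>q\<in>?S. ?B p r * ?B r q * x q)"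
        by (simp add: sum_distrib_left mult.assoc)
      also have "\<dots> = (\<Sum>q\<in>?S. \<Sum>r\<in>?S. ?B p r * ?B r q * x q)"
        by (rule sum.swap)
      finally show ?thesis
        using True by (simp add: mat_vec_def M_def distrib_right sum.distrib sum_distrib_right)
    qed (simp add: mat_vec_def)
  qed simp
  \<comment> \<open>The factor 4 comes from the free initial values of two gap functions.\<close>
  then have faces: "2 ^ f = 4 * card (mat_ker ?S M)"
    using card_faces card_gap_funs[OF code nonempty] unfolding f_def by simp
  \<comment> \<open>There are \<open>n\<close> vertices, \<open>2 * n\<close> edges and
    \<open>f\<close> faces.\<close>
  have "map_connectivity F s0 s1 s2 = 2 + int n - int f"
    unfolding map_connectivity_def map_euler_char_def card_vertices card_edges n_def f_def
    using length_gauss_code[OF code] by simp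
  then have "map_connectivity F s0 s1 s2 \<le> 1 \<longleftrightarrow> Suc n \<le> f" by auto
  also have "\<dots> \<longleftrightarrow> (2::nat) ^ Suc n \<le> 2 ^ f"
    by (rule power_increasing_iff[symmetric]) simp
  also have "\<dots> \<longleftrightarrow> 2 ^ n \<le> 2 * card (mat_ker ?S M)" unfolding faces by simp
  also have "\<dots> \<longleftrightarrow> (\<forall>p\<in>?S. \<forall>q\<in>?S. M p q = M p p * M q q)"
    unfolding n_def
  proof (rule large_mat_ker_iff)
    have "?B p q = ?B q p" for p q
      using interlaced_sym[OF code] by (auto simp: interlace_mat_def of_bool_def)
    then show "M p q = M q p" for p q
      unfolding M_def by (simp add: mult.commute)
  qed simp
  also have "\<dots> \<longleftrightarrow> (\<forall>y\<in>?S. \<forall>z\<in>?S.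
     odd (card (interlaced_set X y \<inter> interlaced_set X z)
          + card (interlaced_set X y) * card (interlaced_set X z))
     \<longleftrightarrow> (interlaced X y z \<and> col y = col z))"
  proof (intro ball_cong refl)
    let ?I = "interlaced_set X"
    \<comment> \<open>Only \<open>r = p\<close> and \<open>r = q\<close> meet the diagonal of
      \<open>?B\<close>. For distinct \<open>p\<close>, \<open>q\<close> they contribute the
      interlacement bit times the sum of both colours, and adding \<open>?B p q\<close> turns this
      into equality of colours; for \<open>p = q\<close> the colour bits cancel.\<close>
    have M: "M p q = of_nat (card (?I p \<inter> ?I q)) + of_bool (interlaced X p q \<and> col p = col q)"
      if pq: "p \<in> ?S" "q \<in> ?S" for p q
    proof -
      have mem: "r \<in> ?I p \<longleftrightarrow> interlaced X p r" "r \<in> ?I q \<longleftrightarrow> interlaced X r q" for r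
        using interlaced_sym[OF code] by (auto simp: interlaced_set_def)
      have irrefl: "\<not> interlaced X r r" for r by (simp add: interlaced_def)
      have "(\<Sum>r\<in>?S. ?B p r * ?B r q) =
          (\<Sum>r\<in>?S. of_bool (r \<in> ?I p \<inter> ?I q) +
            ((if r = q then of_bool (interlaced X p q) * of_bool (col q) else 0) +
            (if r = p then of_bool (col p) * ?B p q else 0)))"
        by (rule sum.cong) (auto simp: interlace_mat_def mem irrefl distrib_left distrib_right)
      also have "\<dots> = of_nat (card (?I p \<inter> ?I q)) +
          (of_bool (interlaced X p q) * of_bool (col q) + of_bool (col p) * ?B p q)"
      proof -
        have "?S \<inter> {r. r \<in> ?I p \<inter> ?I q} = ?I p \<inter> ?I q"
          using interlaced_set_subset[of X p] by blast
        then have "(\<Sum>r\<in>?S. of_bool (r \<in> ?I p \<inter> ?I q)) = (of_nat (card (?I p \<inter> ?I q)) :: bit)"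
          by (simp only: sum_of_bool_eq finite_set)
        then show ?thesis using pq by (simp only: sum.distrib) simp
      qed
      finally show ?thesis
        unfolding M_def interlace_mat_def
        by (cases "p = q"; cases "interlaced X p q"; cases "col p"; cases "col q")
          (auto simp: interlaced_def ac_simps)
    qed
    fix y z assume yz: "y \<in> ?S" "z \<in> ?S"
    have diag: "M p p = of_nat (card (?I p))" if "p \<in> ?S" for p
      using M[OF that that] by (simp add: interlaced_def)
    have "M y z = M y y * M z z \<longleftrightarrow>
        (of_nat (card (?I y \<inter> ?I z) + card (?I y) * card (?I z)) :: bit)
        = of_bool (interlaced X y z \<and> col y = col z)"
      unfolding diag[OF yz(1)] diag[OF yz(2)] M[OF yz] of_nat_add of_nat_mult
      by (simp add: bit_add_eq_iff add.commute)
    also have "\<dots> \<longleftrightarrow> (odd (card (?I y \<inter> ?I z) + card (?I y) * card (?I z))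
        \<longleftrightarrow> (interlaced X y z \<and> col y = col z))"
      unfolding of_nat_bit by (auto simp: of_bool_def)
    finally show "M y z = M y y * M z z \<longleftrightarrow> (odd (card (?I y \<inter> ?I z) + card (?I y) * card (?I z))
        \<longleftrightarrow> (interlaced X y z \<and> col y = col z))" .
  qed
  finally show ?thesis .
qed

end

section \<open>Every realization has a normal form\<close>

text \<open>Both images are in bijection with the common fibres. This equates the number of vertices
  with the number of symbols.\<close>

lemma card_image_eq_card_image:
  assumes "\<And>f g. f \<in> A \<Longrightarrow> g \<in> A \<Longrightarrow> h f = h g \<longleftrightarrow> k f = k g"
  shows "card (h ` A) = card (k ` A)"
proof (rule bij_betw_same_card)
  have k: "k (inv_into A h (h f)) = k f" if "f \<in> A" for f
    using assms[of "inv_into A h (h f)" f] that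
    by (metis f_inv_into_f image_eqI inv_into_into)
  show "bij_betw (\<lambda>c. k (inv_into A h c)) (h ` A) (k ` A)"
    unfolding bij_betw_def
  proof
    show "inj_on (\<lambda>c. k (inv_into A h c)) (h ` A)"
      by (rule inj_onI) (use assms k in auto)
    show "(\<lambda>c. k (inv_into A h c)) ` h ` A = k ` A"
      unfolding image_image by (rule image_cong) (use k in auto)
  qed
qed

text \<open>Flags are named along the smooth path: iterates of the smooth step give the incoming
  flags on one side, \<open>s2\<close> and the opposite dart give the others. Counting shows that
  all flags are reached, and one bit per symbol then describes \<open>s1\<close>.\<close>

lemma coded_map_of_realization:
  assumes code: "gauss_code X" and nonempty: "X \<noteq> []"
    and map: "is_map F s0 s1 s2" and regular: "four_regular F s0 s1 s2"
    and colourable: "faces_two_colourable F s0 s1 s2"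
    and path: "one_smooth_path F s0 s1 s2" and real: "realizes X F s0 s1 s2 \<phi>"
  obtains \<psi> col where "coded_map X F s0 s1 s2 \<psi> col"
proof -
  let ?N = "length X"
  have fin: "finite F" and inv: "fpf_involution_on F s0" "fpf_involution_on F s1" "fpf_involution_on F s2"
    using map unfolding is_map_def by blast+
  have comm02: "s0 (s2 g) = s2 (s0 g)" if "g \<in> F" for g
    using map that unfolding is_map_def by blast
  have cl: "s0 g \<in> F" "s1 g \<in> F" "s2 g \<in> F" if "g \<in> F" for g
    using inv that unfolding fpf_involution_on_def by blast+
  have invol: "s0 (s0 g) = g" "s1 (s1 g) = g" "s2 (s2 g) = g" if "g \<in> F" for g
    using inv that unfolding fpf_involution_on_def by blast+
  obtain c :: "nat \<Rightarrow> bool"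
    where colouring: "\<forall>f\<in>F. c (s0 f) = c f \<and> c (s1 f) = c f \<and> c (s2 f) \<noteq> c f"
    using colourable[unfolded faces_two_colourable_def] by (rule exE)
  have c: "c (s0 g) = c g" "c (s1 g) = c g" "c (s2 g) = (\<not> c g)" if "g \<in> F" for g
    using bspec[OF colouring that] by simp_all
  note real_conjs = real[unfolded realizes_def]
  have \<phi>: "\<phi> (s1 g) = \<phi> g" "\<phi> (s2 g) = \<phi> g" if "g \<in> F" for g
    using bspec[OF conjunct1[OF real_conjs] that] by simp_all
  have \<phi>_orbit: "g \<in> orbit_of F {s1, s2} f" if "f \<in> F" "g \<in> F" "\<phi> f = \<phi> g" for f g
    by (rule mp[OF bspec[OF bspec[OF conjunct1[OF conjunct2[OF real_conjs]] that(1)] that(2)] that(3)])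
  have \<phi>_onto: "\<phi> ` F = set X"
    by (rule conjunct1[OF conjunct2[OF conjunct2[OF real_conjs]]])
  obtain f0 where f0: "f0 \<in> F"
    and word: "\<And>k. \<phi> ((smooth_step s0 s1 s2 ^^ k) f0) = X ! (k mod ?N)"
    using conjunct2[OF conjunct2[OF conjunct2[OF real_conjs]]] 
    by (elim bexE) (rule that, assumption, erule spec)

  have regular': "card (orbit_of F {s1, s2} g) = 2 * 4" if "g \<in> F" for g
    using regular that unfolding four_regular_def by simp
  have card_F: "card F = 4 * ?N"
  proof -
    have "card (orbit_of F {s1, s2} ` F) = card (\<phi> ` F)"
    proof (rule card_image_eq_card_image)
      fix f g assume fg: "f \<in> F" "g \<in> F"
      have inv12: "\<And>s. s \<in> {s1, s2} \<Longrightarrow> fpf_involution_on F s" using inv by blast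
      show "orbit_of F {s1, s2} f = orbit_of F {s1, s2} g \<longleftrightarrow> \<phi> f = \<phi> g"
      proof
        assume "orbit_of F {s1, s2} f = orbit_of F {s1, s2} g"
        then have "g \<in> orbit_of F {s1, s2} f" using orbit_of_refl by simp
        moreover have "orbit_of F {s1, s2} f \<subseteq> {h \<in> F. \<phi> h = \<phi> f}"
          by (rule orbit_of_least) (use fg cl \<phi> in auto)
        ultimately show "\<phi> f = \<phi> g" by auto
      next
        assume "\<phi> f = \<phi> g"
        then show "orbit_of F {s1, s2} f = orbit_of F {s1, s2} g"
          using orbit_of_eq[OF inv12 fg(1) \<phi>_orbit[OF fg]] by simp
      qed
    qed
    also note \<phi>_onto
    finally have "8 * card (set X) = card F"
      using card_orbits[OF fin, of "{s1, s2}" 8] inv regular' by auto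
    then show ?thesis using length_gauss_code[OF code] by simp
  qed

  \<comment> \<open>The flag on the opposite dart; in degree four this is an involution.\<close>
  define opp where "opp g = s2 (s1 (s2 (s1 g)))" for g
  have opp_in: "opp g \<in> F" if "g \<in> F" for g
    using that by (simp add: opp_def cl)
  have opp_opp: "opp (opp g) = g" if "g \<in> F" for g
    using dihedral_orbit(1)[OF fin inv(2,3) that regular'[OF that]]
    by (simp add: opp_def eval_nat_numeral)
  have opp_ne: "opp g \<noteq> g" if "g \<in> F" for g
    using inj_onD[OF dihedral_orbit(2)[OF fin inv(2,3) that regular'[OF that]], of 0 2]
    by (auto simp: opp_def eval_nat_numeral)
  have s1_ne_opp: "s1 g \<noteq> opp g" if "g \<in> F" for g
    using involution_ne_funpow[OF inv(2,3) that, of 2] by (simp add: opp_def eval_nat_numeral)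
  have inv_opp: "fpf_involution_on F opp"
    unfolding fpf_involution_on_def using opp_in opp_opp opp_ne by blast
  have opp_s2: "opp (s2 g) = s2 (opp g)" if "g \<in> F" for g
  proof -
    have "opp (opp (s1 (s2 (s1 g)))) = s1 (s2 (s1 g))"
      using that by (intro opp_opp) (simp add: cl)
    then have "opp (s2 g) = s1 (s2 (s1 g))"
      using that by (simp add: opp_def cl invol)
    then show ?thesis using that by (simp add: opp_def cl invol)
  qed
  have c_opp: "c (opp g) = c g" if "g \<in> F" for g
    using that by (simp add: opp_def cl c)
  have \<phi>_opp: "\<phi> (opp g) = \<phi> g" if "g \<in> F" for g
    using that by (simp add: opp_def cl \<phi>)
  have step: "smooth_step s0 s1 s2 = (\<lambda>g. s0 (opp g))"
    by (rule ext) (simp add: smooth_step_def opp_def)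

  \<comment> \<open>Of the maps involved only \<open>s2\<close> changes the face colour. Hence the
    flags split into \<open>Orb\<close> and its image under \<open>s2\<close>, and
    \<open>Orb\<close> contains half of them.\<close>
  define Orb where "Orb = orbit_of F {opp, s0} f0"
  have O_F: "Orb \<subseteq> F"
    unfolding Orb_def by (rule orbit_of_subset) (use inv_opp inv f0 in auto)
  have O_cl: "opp g \<in> Orb" "s0 g \<in> Orb" if "g \<in> Orb" for g
    using orbit_of_step[of g F "{opp, s0}" f0 opp] orbit_of_step[of g F "{opp, s0}" f0 s0] that O_F
    unfolding Orb_def by blast+
  have c_O: "c g = c f0" if "g \<in> Orb" for g
  proof -
    have "Orb \<subseteq> {g \<in> F. c g = c f0}"
      unfolding Orb_def by (rule orbit_of_least) (use f0 opp_in cl c_opp c in auto)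
    then show ?thesis using that by blast
  qed
  have "F \<subseteq> Orb \<union> s2 ` Orb"
  proof -
    have "orbit_of F {smooth_step s0 s1 s2, s0, s2} f0 \<subseteq> Orb \<union> s2 ` Orb"
    proof (rule orbit_of_least)
      show "f0 \<in> Orb \<union> s2 ` Orb" unfolding Orb_def using orbit_of_refl by blast
      fix g s assume g: "g \<in> Orb \<union> s2 ` Orb" and s: "s \<in> {smooth_step s0 s1 s2, s0, s2}"
      from g obtain h where h: "h \<in> Orb" "g = h \<or> g = s2 h" by blast
      have hF: "h \<in> F" using h O_F by blast
      have s2h: "s0 (s2 h) = s2 (s0 h)" "s0 (opp (s2 h)) = s2 (s0 (opp h))" "s2 (s2 h) = h"
        using hF opp_in[OF hF] by (simp_all add: comm02 opp_s2 invol)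
      have "s0 g \<in> Orb \<union> s2 ` Orb" "s0 (opp g) \<in> Orb \<union> s2 ` Orb" "s2 g \<in> Orb \<union> s2 ` Orb"
        using h(2) s2h h(1) O_cl[OF h(1)] O_cl(2)[OF O_cl(1)[OF h(1)]] by (elim disjE; simp)+
      then show "s g \<in> Orb \<union> s2 ` Orb" using s unfolding step by blast
    qed
    then show ?thesis using path f0 unfolding one_smooth_path_def by blast
  qed
  moreover have "s2 ` Orb \<subseteq> F" using O_F cl by blast
  ultimately have F_eq: "F = Orb \<union> s2 ` Orb" using O_F by blast
  have "Orb \<inter> s2 ` Orb = {}"
  proof -
    have "c (s2 g) \<noteq> c f0" if "g \<in> Orb" for g
      using c_O[OF that] c(3)[of g] that O_F by auto
    then show ?thesis using c_O by blast
  qed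
  moreover have "card (s2 ` Orb) = card Orb"
    by (rule card_image, rule inj_on_inverseI[of _ s2]) (use invol O_F in auto)
  moreover have "finite Orb" using O_F fin finite_subset by blast
  ultimately have "card Orb = 2 * ?N"
    using card_F unfolding F_eq by (simp add: card_Un_disjoint)
  then have card_O: "card (orbit_of F {opp, s0} f0) = 2 * ?N" unfolding Orb_def .

  \<comment> \<open>The incoming flags on one side, in path order; the size of \<open>Orb\<close>
    makes \<open>?N\<close> their exact period.\<close>
  define w where "w i = (smooth_step s0 s1 s2 ^^ i) f0" for i
  have w_Suc: "w (Suc i) = s0 (opp (w i))" for i
    unfolding w_def step by simp
  have w_F: "w i \<in> F" for i
    by (induction i) (simp_all only: w_Suc cl opp_in, simp add: w_def f0)
  have w_add: "w (k + i) = ((\<lambda>g. s0 (opp g)) ^^ k) (w i)" for i k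
    unfolding w_def step by (simp add: funpow_add)
  have w_period: "w (i + ?N) = w i" for i
  proof -
    have "w ?N = w 0"
      unfolding w_def step using dihedral_orbit(1)[OF fin inv_opp inv(1) f0 card_O] by simp
    then show ?thesis using w_add[of i ?N] w_add[of i 0] by simp
  qed
  have w_inj: "i = j" if "i < ?N" "j < ?N" "w i = w j" for i j
    using inj_onD[OF dihedral_orbit(2)[OF fin inv_opp inv(1) f0 card_O], of i j] that
    unfolding w_def step by simp
  \<comment> \<open>Otherwise an alternating word of odd length in \<open>opp\<close> and
    \<open>s0\<close> would have a fixed point. The summand \<open>?N\<close> keeps the exponent
    nonnegative.\<close>
  have opp_w: "opp (w i) \<noteq> w j" if "i < ?N" for i j
  proof -
    have "w j = w (j + ?N - i + i)" using that w_period by simp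
    also have "\<dots> = ((\<lambda>g. s0 (opp g)) ^^ (j + ?N - i)) (w i)" by (rule w_add)
    finally show ?thesis
      using involution_ne_funpow[OF inv_opp inv(1) w_F, of i "j + ?N - i"] by simp
  qed
  have c_w: "c (w i) = c f0" for i
    by (induction i) (simp_all add: w_Suc c c_opp opp_in w_F, simp add: w_def)
  have \<phi>_w: "\<phi> (w i) = X ! (i mod ?N)" for i
    unfolding w_def by (rule word)

  define \<psi> where "\<psi> i s e = (if e then opp else id) ((if s then s2 else id) (w i))" for i s e
  have side_F: "(if s then s2 else id) (w i) \<in> F" for i s
    using cl(3)[OF w_F] w_F by simp
  have \<psi>_F: "\<psi> i s e \<in> F" for i s e
    unfolding \<psi>_def using opp_in[OF side_F] side_F by simp
  have \<psi>_out: "\<psi> i s True = opp (\<psi> i s False)" for i s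
    by (simp add: \<psi>_def)
  have \<psi>_opp: "opp (\<psi> i s e) = \<psi> i s (\<not> e)" for i s e
    by (cases e) (simp_all add: \<psi>_out opp_opp \<psi>_F)
  have c_\<psi>: "c (\<psi> i s e) = (c f0 \<noteq> s)" for i s e
    by (cases e; cases s) (simp_all add: \<psi>_def c_opp c c_w cl w_F)
  have \<phi>_\<psi>: "\<phi> (\<psi> i s e) = X ! (i mod ?N)" for i s e
    by (cases e; cases s) (simp_all add: \<psi>_def \<phi>_opp \<phi> \<phi>_w cl w_F)
  have \<psi>_s2: "s2 (\<psi> i s e) = \<psi> i (\<not> s) e" for i s e
    by (cases e; cases s) (simp_all add: \<psi>_def opp_s2 invol w_F cl opp_in)
  have \<psi>_s0: "s0 (\<psi> i s True) = \<psi> (Suc i) s False" for i s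
    by (cases s) (simp_all add: \<psi>_def opp_s2 w_Suc comm02 w_F opp_in)
  \<comment> \<open>The face colour tells the sides apart, \<open>opp_w\<close> the directions and
    \<open>w_inj\<close> the positions.\<close>
  have \<psi>_inj: "i = j \<and> s = s' \<and> e = e'"
    if ij: "i < ?N" "j < ?N" and eq: "\<psi> i s e = \<psi> j s' e'" for i j s s' e e'
  proof -
    have s: "s = s'" using arg_cong[OF eq, of c] by (auto simp: c_\<psi>)
    have eq': "\<psi> i False e = \<psi> j False e'"
      using eq arg_cong[OF eq, of s2] unfolding s \<psi>_s2 by (cases s') simp_all
    have "e = e'"
    proof (rule ccontr)
      assume "e \<noteq> e'"
      then consider "e" "\<not> e'" | "\<not> e" "e'" by blast
      then show False
      proof cases
        case 1 then show False using eq' opp_w[OF ij(1), of j] by (simp add: \<psi>_def)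
      next
        case 2 then show False using eq' opp_w[OF ij(2), of i] by (simp add: \<psi>_def)
      qed
    qed
    moreover have "w i = w j"
      using eq' arg_cong[OF eq', of opp] unfolding \<open>e = e'\<close> \<psi>_opp
      by (cases e') (simp_all add: \<psi>_def)
    ultimately show ?thesis using w_inj[OF ij] s by blast
  qed
  have \<psi>_onto: "F = {\<psi> i s e | i s e. i < ?N}"
  proof -
    let ?P = "(\<lambda>(i, s, e). \<psi> i s e) ` ({..<?N} \<times> (UNIV :: bool set) \<times> (UNIV :: bool set))"
    have "inj_on (\<lambda>(i, s, e). \<psi> i s e) ({..<?N} \<times> UNIV \<times> UNIV)"
      using \<psi>_inj by (fastforce simp: inj_on_def)
    then have "card ?P = 4 * ?N"
      by (simp add: card_image card_cartesian_product card_UNIV_bool_pair)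
    moreover have "?P \<subseteq> F" using \<psi>_F by auto
    ultimately have "?P = F" using card_F fin by (simp add: card_subset_eq)
    moreover have "?P = {\<psi> i s e | i s e. i < ?N}"
      by (auto simp: image_iff) blast
    ultimately show ?thesis by simp
  qed

  \<comment> \<open>At the given flag \<open>s1\<close> acts as the bit \<open>d\<close> prescribes.
    The aim is one \<open>d\<close> for all eight flags of a vertex.\<close>
  define T where "T i j s e d \<longleftrightarrow> s1 (\<psi> i s e) = \<psi> j s (e = (s = d))" for i j s e d
  have T_ex: "\<exists>d. T i j s e d" if ij: "i < ?N" "j < ?N" "i \<noteq> j" "X ! i = X ! j" for i j s e
  proof -
    have "s1 (\<psi> i s e) \<in> F" using cl \<psi>_F by blast
    then obtain k s' e' where k: "k < ?N" "s1 (\<psi> i s e) = \<psi> k s' e'"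
      using \<psi>_onto by blast
    have "s' = s" using arg_cong[OF k(2), of c] by (auto simp: c \<psi>_F c_\<psi>)
    have "X ! k = X ! i" using arg_cong[OF k(2), of \<phi>] k(1) ij by (simp add: \<phi> \<psi>_F \<phi>_\<psi>)
    \<comment> \<open>On this side, position \<open>i\<close> has only the flag itself and its
      opposite, and \<open>s1\<close> reaches neither.\<close>
    moreover have "k \<noteq> i"
    proof
      assume "k = i"
      then have "s1 (\<psi> i s e) = \<psi> i s e \<or> s1 (\<psi> i s e) = opp (\<psi> i s e)"
        using k(2) \<open>s' = s\<close> by (cases "e' = e") (auto simp: \<psi>_opp)
      then show False
        using s1_ne_opp[OF \<psi>_F] inv(2) \<psi>_F unfolding fpf_involution_on_def by blast
    qed
    ultimately have "k = j"
      using other_occurrence[OF code ij(1)] k(1) ij by metis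
    then have "s1 (\<psi> i s e) = \<psi> j s e'" using k \<open>s' = s\<close> by simp
    then show ?thesis
      \<comment> \<open>The witness solves \<open>e' = (e = (s = d))\<close> for
        \<open>d\<close>.\<close>
      unfolding T_def by (intro exI[of _ "(e' = e) = s"]) (cases s; cases e; cases e'; simp)
  qed
  have T_swap: "T j i s (e = (s = d)) d" if "T i j s e d" for i j s e d
  proof -
    have "s1 (\<psi> j s (e = (s = d))) = \<psi> i s e"
      using that[unfolded T_def, symmetric] invol \<psi>_F by simp
    moreover have "((e = (s = d)) = (s = d)) = e" by blast
    ultimately show ?thesis unfolding T_def by simp
  qed
  have T_opp: "T i j (\<not> s) (\<not> e) d" if "T i j s e d" for i j s e d
  proof -
    have "s2 (s1 (s2 (s1 (\<psi> i s e)))) = \<psi> i s (\<not> e)"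
      using \<psi>_opp[of i s e] by (simp add: opp_def)
    then have "s1 (s2 (\<psi> i s (\<not> e))) = s2 (s1 (\<psi> i s e))"
      by (metis cl invol \<psi>_F)
    then have "s1 (\<psi> i (\<not> s) (\<not> e)) = \<psi> j (\<not> s) (e = (s = d))"
      using that by (simp add: T_def \<psi>_s2)
    moreover have "(e = (s = d)) = ((\<not> e) = ((\<not> s) = d))" by blast
    ultimately show ?thesis unfolding T_def by simp
  qed
  have T_all: "T i j s' e' d \<and> T j i s' e' d" if T: "T i j s e d" for i j s e d s' e'
  proof -
    \<comment> \<open>Passing to \<open>j\<close>, applying \<open>T_opp\<close> there and returning
      flips the side alone.\<close>
    have 1: "T i j (\<not> s) e d"
    proof -
      have "T i j (\<not> s) ((\<not> (e = (s = d))) = ((\<not> s) = d)) d"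
        by (rule T_swap[OF T_opp[OF T_swap[OF T]]])
      moreover have "((\<not> (e = (s = d))) = ((\<not> s) = d)) = e" by blast
      ultimately show ?thesis by simp
    qed
    have ij: "T i j s' e' d" for s' e'
      using T 1 T_opp[OF T] T_opp[OF 1] by (cases "s' = s"; cases "e' = e") simp_all
    have "((e' = (s' = d)) = (s' = d)) = e'" by blast
    then show ?thesis using ij T_swap[OF ij[of s' "e' = (s' = d)"]] by simp
  qed
  \<comment> \<open>For \<open>s\<close> and \<open>e\<close> both true, the direction after
    \<open>s1\<close> is the bit itself. By \<open>T_all\<close> the order of the two occurrences is
    immaterial.\<close>
  define col where "col p \<longleftrightarrow> (\<exists>i j. i < ?N \<and> j < ?N \<and> i \<noteq> j \<and> X ! i = p \<and> X ! j = p \<and>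
      T i j True True True)" for p
  have T_col: "T i j s e (col (X ! i))" if ij: "i < ?N" "j < ?N" "i \<noteq> j" "X ! i = X ! j" for i j s e
  proof -
    obtain d where d: "T i j s e d" using T_ex[OF ij] by blast
    have "col (X ! i) = d"
    proof
      assume d
      then have "T i j True True True" using T_all[OF d, of True True] by simp
      then show "col (X ! i)" unfolding col_def using ij by metis
    next
      assume "col (X ! i)"
      then obtain i' j' where i'j': "i' < ?N" "j' < ?N" "i' \<noteq> j'" "X ! i' = X ! i" "X ! j' = X ! i"
        and T': "T i' j' True True True"
        unfolding col_def by blast
      have "i' = i \<or> i' = j" "j' = i \<or> j' = j"
        using other_occurrence[OF code ij(1)] i'j' ij by metis+
      then have "T i' j' True True d"
        using T_all[OF d, of True True] i'j'(3) by auto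
      then have "\<psi> j' True True = \<psi> j' True d"
        using T' unfolding T_def by simp
      then show d using \<psi>_inj[OF i'j'(2,2), of True True True d] by simp
    qed
    then show ?thesis using d by simp
  qed
  have "coded_map X F s0 s1 s2 \<psi> col"
  proof
    show "\<psi> (i + ?N) s e = \<psi> i s e" for i s e
      by (simp add: \<psi>_def w_period)
    show "s0 (\<psi> (Suc i) s False) = \<psi> i s True" for i s
      using arg_cong[OF \<psi>_s0[of i s], of s0] by (simp add: invol \<psi>_F)
    show "s1 (\<psi> i s e) = \<psi> j s (e = (s = col (X ! i)))"
      if "i < ?N" "j < ?N" "i \<noteq> j" "X ! i = X ! j" for i j s e
      using T_col[OF that] unfolding T_def .
  qed (use code nonempty \<psi>_onto \<psi>_inj \<psi>_s0 \<psi>_s2 in blast)+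
  then show ?thesis by (rule that)
qed

section \<open>Constructing a map from a coloured code\<close>

lemma coded_map_exists:
  fixes X :: "'a list" and col :: "'a \<Rightarrow> bool"
  assumes code: "gauss_code X" and nonempty: "X \<noteq> []"
  obtains F s0 s1 s2 \<psi> \<phi> where "coded_map X F s0 s1 s2 \<psi> col"
    "\<forall>i<length X. \<forall>s e. \<phi> (\<psi> i s e) = X ! i"
proof -
  let ?N = "length X"
  have N: "?N > 0" using nonempty by simp
  \<comment> \<open>Position, side and direction are packed into one number, the latter two as its
    last binary digits.\<close>
  define \<psi> :: "nat \<Rightarrow> bool \<Rightarrow> bool \<Rightarrow> nat"
    where "\<psi> i s e = 4 * (i mod ?N) + 2 * of_bool s + of_bool e" for i s e
  define pos side out
    where "pos f = f div 4" and "side f = odd (f div 2)" and "out f = odd f" for f :: nat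
  have dec: "pos (\<psi> i s e) = i mod ?N" "side (\<psi> i s e) = s" "out (\<psi> i s e) = e" for i s e
    by (cases s; cases e; simp add: pos_def side_def out_def \<psi>_def)+
  define mate where "mate i = (SOME j. j < ?N \<and> j \<noteq> i \<and> X ! j = X ! i)" for i
  define F where "F = {\<psi> i s e | i s e. i < ?N}"
  \<comment> \<open>Adding \<open>?N - 1\<close> steps back by one position, since
    \<open>\<psi>\<close> reduces modulo \<open>?N\<close>.\<close>
  define s0 where "s0 f = (if out f then \<psi> (Suc (pos f)) (side f) False
    else \<psi> (pos f + (?N - 1)) (side f) True)" for f
  define s1 where "s1 f = \<psi> (mate (pos f)) (side f) (out f = (side f = col (X ! pos f)))" for f
  define s2 where "s2 f = \<psi> (pos f) (\<not> side f) (out f)" for f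
  have \<psi>_cong: "\<psi> i s e = \<psi> j s e" if "i mod ?N = j mod ?N" for i j s e
    using that by (simp add: \<psi>_def)
  have mate: "mate i = j" if ij: "i < ?N" "j < ?N" "i \<noteq> j" "X ! i = X ! j" for i j
  proof -
    have "mate i < ?N \<and> mate i \<noteq> i \<and> X ! mate i = X ! i"
      unfolding mate_def by (rule someI[of _ j]) (use ij in simp)
    then show ?thesis using other_occurrence[OF code ij(1)] ij by metis
  qed
  have "coded_map X F s0 s1 s2 \<psi> col"
  proof
    show "i = j \<and> s = s' \<and> e = e'"
      if "i < ?N" "j < ?N" and eq: "\<psi> i s e = \<psi> j s' e'" for i j s s' e e'
      using arg_cong[OF eq, of pos] arg_cong[OF eq, of side] arg_cong[OF eq, of out] that(1,2)
      by (simp add: dec)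
    show "s0 (\<psi> i s True) = \<psi> (Suc i) s False" for i s
      unfolding s0_def dec by (simp, rule \<psi>_cong) (simp add: mod_Suc_eq)
    show "s0 (\<psi> (Suc i) s False) = \<psi> i s True" for i s
      unfolding s0_def dec
    proof (simp, rule \<psi>_cong)
      have "(Suc i mod ?N + (?N - 1)) mod ?N = (Suc i + (?N - 1)) mod ?N"
        by (rule mod_add_left_eq)
      also have "Suc i + (?N - 1) = i + ?N" using N by simp
      finally show "(Suc i mod ?N + (?N - Suc 0)) mod ?N = i mod ?N" by simp
    qed
    show "s2 (\<psi> i s e) = \<psi> i (\<not> s) e" for i s e
      unfolding s2_def dec by (rule \<psi>_cong) simp
    show "s1 (\<psi> i s e) = \<psi> j s (e = (s = col (X ! i)))"
      if "i < ?N" "j < ?N" "i \<noteq> j" "X ! i = X ! j" for i j s e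
      unfolding s1_def dec using that by (simp add: mate)
  qed (use code nonempty in \<open>simp_all add: F_def \<psi>_def\<close>)
  moreover have "\<forall>i<?N. \<forall>s e. X ! pos (\<psi> i s e) = X ! i"
    by (simp add: dec)
  ultimately show ?thesis by (rule that)
qed

theorem theorem3p1:
  fixes X :: "'a list"
  assumes "gauss_code X" and "X \<noteq> []"
  shows "(\<exists>k\<le>1. gauss_realizable X k) \<longleftrightarrow>
    (\<exists>col :: 'a \<Rightarrow> bool. \<forall>y\<in>set X. \<forall>z\<in>set X.
       odd (card (interlaced_set X y \<inter> interlaced_set X z)
            + card (interlaced_set X y) * card (interlaced_set X z))
       \<longleftrightarrow> (interlaced X y z \<and> col y = col z))"
    (is "?real \<longleftrightarrow> (\<exists>col. ?colouring col)")
proof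
  assume ?real
  then obtain F s0 s1 s2 \<phi> where le: "map_connectivity F s0 s1 s2 \<le> 1"
    and real: "is_map F s0 s1 s2" "four_regular F s0 s1 s2" "faces_two_colourable F s0 s1 s2"
      "one_smooth_path F s0 s1 s2" "realizes X F s0 s1 s2 \<phi>"
    unfolding gauss_realizable_def by (elim exE conjE) (rule that, simp_all)
  obtain \<psi> col where "coded_map X F s0 s1 s2 \<psi> col"
    by (rule coded_map_of_realization[OF assms real])
  then have "?colouring col" using le coded_map.connectivity_le_1_iff by blast
  then show "\<exists>col. ?colouring col" by (rule exI[of _ col])
next
  assume "\<exists>col. ?colouring col"
  then obtain col where col: "?colouring col" by (rule exE)
  obtain F s0 s1 s2 \<psi> and \<phi> :: "nat \<Rightarrow> 'a" where coded: "coded_map X F s0 s1 s2 \<psi> col"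
    and \<phi>: "\<forall>i<length X. \<forall>s e. \<phi> (\<psi> i s e) = X ! i"
    by (rule coded_map_exists[OF assms, of col])
  interpret coded_map X F s0 s1 s2 \<psi> col by (rule coded)
  have "realizes X F s0 s1 s2 \<phi>" by (rule realizes) (use \<phi> in blast)
  then have "gauss_realizable X (map_connectivity F s0 s1 s2)"
    unfolding gauss_realizable_def
    using is_map four_regular faces_two_colourable one_smooth_path by blast
  moreover have "map_connectivity F s0 s1 s2 \<le> 1"
    using col connectivity_le_1_iff by blast
  ultimately show ?real by blast
qed

end
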